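(* Let $(x,y)\in\mathbb{R}^2$ satisfy $x^2y+3x^2-xy-3y^2-3x-3y=0$ with $0<x<1$ and $-\frac13\le y<0$. Then the four strut triangles of the tensegrity with parameter $(x,y)$ form a $4$-component mutual Hopf link, i.e. every two distinct strut triangles form a Hopf link in $\mathbb{R}^3$.
   Context: Permutations are composed right to left. In the alternating group $A_4$ put $s=g_1=(1,2,3)$, $g_2=(1,2)(3,4)$, $g_3=(1,3)(2,4)$, $c_1=(1,3,4)=g_1g_2$, $c_2=(2,4,3)=g_1g_3$. Let $\rho\colon A_4\to \mathrm{GL}(3,\mathbb{Z})$ be the representation with $$\rho(g_1)=\begin{pmatrix}0&1&0\\0&0&-1\\-1&0&0\end{pmatrix},\quad \rho(g_2)=\mathrm{diag}(1,-1,-1),\quad \rho(g_3)=\mathrm{diag}(-1,1,-1).$$ For real $x,y$ the stress matrix is $$\Omega(x,y)=x\bigl(\rho(c_1)+\rho(c_1^{-1})\bigr)+(1-x)\bigl(\rho(c_2)+\rho(c_2^{-1})\bigr)+y\bigl(\rho(s)+\rho(s^{-1})\bigr)-2(1+y)I_3 ,$$ and $\det\Omega(x,y)=8(x^2y+3x^2-xy-3y^2-3x-3y)$. When this determinant vanishes, the vector $$\mathbf{p}_0=\begin{pmatrix}-2xy+3y^2-6x+2y+3\\-4x^2-4xy+3y^2+4x+10y+3\\4x^2-3y^2-4x+3\end{pmatrix}$$ satisfies $\Omega(x,y)\mathbf{p}_0=\mathbf{0}$. The tensegrity with parameter $(x,y)$ has nodes $\rho(g)\mathbf{p}_0$, $g\in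 A_4$; nodes $\rho(g)\mathbf{p}_0$ and $\rho(h)\mathbf{p}_0$ are joined by a strut (straight segment) if $h=gs$, and by a cable if $h=gc_1$ or $h=gc_2$. The struts form four triangles (closed polygonal curves), one for each left coset $g\langle s\rangle$, with vertices $\rho(g)\mathbf{p}_0,\ \rho(gs)\mathbf{p}_0,\ \rho(gs^2)\mathbf{p}_0$. Two disjoint closed curves in $\mathbb{R}^3$ form a Hopf link if their union is ambient isotopic to the standard Hopf link (orientations are disregarded). *)

theory Defs
  imports
    "HOL-Analysis.Analysis"
    "HOL-Algebra.Sym_Groups"
    "HOL-Algebra.Left_Coset"
begin

section \<open>Hopf links\<close>

text \<open>
  Joint continuity is asked of \<open>H\<close> only; on Euclidean space the inverses \<open>(H t)\<^sup>-\<^sup>1\<close> are then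
  automatically jointly continuous, by invariance of domain.
\<close>

definition ambient_isotopic :: "'a::topological_space set \<Rightarrow> 'a set \<Rightarrow> bool" where
  "ambient_isotopic A B \<longleftrightarrow>
     (\<exists>H :: real \<Rightarrow> 'a \<Rightarrow> 'a.
        continuous_on ({0..1} \<times> UNIV) (\<lambda>(t, z). H t z) \<and>
        (\<forall>t\<in>{0..1}. \<exists>G. homeomorphism UNIV UNIV (H t) G) \<and>
        (\<forall>z. H 0 z = z) \<and>
        H 1 ` A = B)"

text \<open>Two unit circles in perpendicular planes, each passing through the centre of the other.\<close>

definition standard_hopf_link :: "(real^3) set" where
  "standard_hopf_link =
     {vector [cos t, sin t, 0] | t. True} \<union> {vector [1 + cos t, 0, sin t] | t. True}"

definition simple_closed_curve :: "'a::topological_space set \<Rightarrow> bool" where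
  "simple_closed_curve A \<longleftrightarrow>
     (\<exists>\<gamma>. simple_path \<gamma> \<and> pathfinish \<gamma> = pathstart \<gamma> \<and> path_image \<gamma> = A)"

definition forms_hopf_link :: "(real^3) set \<Rightarrow> (real^3) set \<Rightarrow> bool" where
  "forms_hopf_link A B \<longleftrightarrow>
     simple_closed_curve A \<and> simple_closed_curve B \<and> A \<inter> B = {} \<and>
     ambient_isotopic (A \<union> B) standard_hopf_link"

definition mutual_hopf_link :: "nat \<Rightarrow> (real^3) set set \<Rightarrow> bool" where
  "mutual_hopf_link n L \<longleftrightarrow> card L = n \<and> pairwise forms_hopf_link L"


section \<open>The representation of the alternating group\<close>

text \<open>
  Multiplication in \<^term>\<open>alt_group 4\<close> is \<open>(\<circ>)\<close>, i.e. permutations are composed right to left.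
\<close>

abbreviation A4 :: "(nat \<Rightarrow> nat) monoid" where
  "A4 \<equiv> alt_group 4"

definition g1 :: "nat \<Rightarrow> nat" where
  "g1 = cycle_of_list [1, 2, 3]"

definition g2 :: "nat \<Rightarrow> nat" where
  "g2 = cycle_of_list [1, 2] \<circ> cycle_of_list [3, 4]"

definition g3 :: "nat \<Rightarrow> nat" where
  "g3 = cycle_of_list [1, 3] \<circ> cycle_of_list [2, 4]"

definition GL3Z :: "(int^3^3) monoid" where
  "GL3Z = \<lparr>carrier = {A. invertible A}, mult = (**), one = mat 1\<rparr>"

text \<open>
  These conditions determine \<open>\<rho>\<close> on the carrier of \<^term>\<open>A4\<close>, since \<^term>\<open>g1\<close>, \<^term>\<open>g2\<close>,
  \<^term>\<open>g3\<close> generate the group; existence is shown in \<open>A4_representation_exists\<close> below.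
\<close>

definition A4_representation :: "((nat \<Rightarrow> nat) \<Rightarrow> int^3^3) \<Rightarrow> bool" where
  "A4_representation \<rho> \<longleftrightarrow>
     \<rho> \<in> hom A4 GL3Z \<and>
     \<rho> g1 = vector [vector [0, 1, 0], vector [0, 0, -1], vector [-1, 0, 0]] \<and>
     \<rho> g2 = vector [vector [1, 0, 0], vector [0, -1, 0], vector [0, 0, -1]] \<and>
     \<rho> g3 = vector [vector [-1, 0, 0], vector [0, 1, 0], vector [0, 0, -1]]"


definition tetra_vertex :: "nat \<Rightarrow> int^3" where
  "tetra_vertex i = (if i = 1 then vector [-1,-1,-1] else if i = 2 then vector [-1,1,1]
           else if i = 3 then vector [1,-1,1] else vector [1,1,-1])"

definition vertex_sum :: "(nat \<Rightarrow> nat) \<Rightarrow> int^3^3" where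
  "vertex_sum g = (\<chi> a b. \<Sum>i\<in>{1..4}. tetra_vertex (g i) $ a * tetra_vertex i $ b)"

definition tetra_matrix :: "(nat \<Rightarrow> nat) \<Rightarrow> int^3^3" where
  "tetra_matrix g = (\<chi> a b. vertex_sum g $ a $ b div 4)"

text \<open>
  Existence: \<^term>\<open>tetra_matrix g\<close> is the linear map that permutes the vertices
  \<^term>\<open>tetra_vertex i\<close> of a regular tetrahedron according to \<open>g\<close>, namely
  \<open>1/4 (\<Sum>i. v (g i) (v i)\<^sup>T)\<close> for the vertices \<open>v i\<close>.
\<close>

lemma atLeastAtMost_1_4: "{1..4::nat} = {1,2,3,4}" by auto

lemma tetra_vertex_inner: "i \<in> {1..4} \<Longrightarrow> j \<in> {1..4} \<Longrightarrow>
   (\<Sum>c\<in>UNIV. tetra_vertex i $ c * tetra_vertex j $ c) = (if i = j then 4 else 0) - 1"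
  unfolding atLeastAtMost_1_4 by (auto simp: tetra_vertex_def sum_3)

lemma tetra_vertex_sum_zero: "(\<Sum>i\<in>{1..4}. tetra_vertex i $ b) = 0"
  unfolding atLeastAtMost_1_4 using exhaust_3[of b] by (auto simp: tetra_vertex_def)

lemma vertex_sum_mult:
  assumes g: "g permutes {1..4}" and h: "h permutes {1..4}"
  shows "(vertex_sum g ** vertex_sum h) $ a $ b = 4 * vertex_sum (g \<circ> h) $ a $ b"
proof -
  have hj: "h j \<in> {1..4}" if "j \<in> {1..4}" for j by (simp only: permutes_in_image[OF h] that)
  have "(vertex_sum g ** vertex_sum h) $ a $ b =
    (\<Sum>c\<in>UNIV. \<Sum>i\<in>{1..4}. \<Sum>j\<in>{1..4}. tetra_vertex (g i) $ a * (tetra_vertex i $ c * tetra_vertex (h j) $ c) * tetra_vertex j $ b)"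
    unfolding matrix_matrix_mult_def vertex_sum_def vec_lambda_beta sum_product
    by (intro sum.cong refl) (simp only: mult_ac)
  also have "\<dots> = (\<Sum>i\<in>{1..4}. \<Sum>j\<in>{1..4}. \<Sum>c\<in>UNIV. tetra_vertex (g i) $ a * (tetra_vertex i $ c * tetra_vertex (h j) $ c) * tetra_vertex j $ b)"
    by (subst sum.swap) (intro sum.cong refl, rule sum.swap)
  also have "\<dots> = (\<Sum>i\<in>{1..4}. \<Sum>j\<in>{1..4}. tetra_vertex (g i) $ a * (\<Sum>c\<in>UNIV. tetra_vertex i $ c * tetra_vertex (h j) $ c) * tetra_vertex j $ b)"
    by (simp add: sum_distrib_left sum_distrib_right)
  also have "\<dots> = (\<Sum>i\<in>{1..4}. \<Sum>j\<in>{1..4}. tetra_vertex (g i) $ a * ((if i = h j then 4 else 0) - 1) * tetra_vertex j $ b)"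
    by (intro sum.cong refl) (simp only: tetra_vertex_inner hj)
  also have "\<dots> = (\<Sum>i\<in>{1..4}. \<Sum>j\<in>{1..4}. (if i = h j then 4 * (tetra_vertex (g i) $ a * tetra_vertex j $ b) else 0))
        - (\<Sum>i\<in>{1..4}. \<Sum>j\<in>{1..4}. tetra_vertex (g i) $ a * tetra_vertex j $ b)"
    unfolding sum_subtractf[symmetric] by (intro sum.cong refl) (simp add: algebra_simps)
  also have "(\<Sum>i\<in>{1..4}. \<Sum>j\<in>{1..4}. tetra_vertex (g i) $ a * tetra_vertex j $ b) = 0"
    by (simp only: sum_distrib_left[symmetric] tetra_vertex_sum_zero) simp
  also have "(\<Sum>i\<in>{1..4}. \<Sum>j\<in>{1..4}. (if i = h j then 4 * (tetra_vertex (g i) $ a * tetra_vertex j $ b) else 0))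
     = (\<Sum>j\<in>{1..4}. \<Sum>i\<in>{1..4}. (if i = h j then 4 * (tetra_vertex (g i) $ a * tetra_vertex j $ b) else 0))"
    by (rule sum.swap)
  also have "\<dots> = (\<Sum>j\<in>{1..4}. 4 * (tetra_vertex (g (h j)) $ a * tetra_vertex j $ b))"
    by (intro sum.cong refl) (use hj in simp)
  finally show ?thesis by (simp add: vertex_sum_def sum_distrib_left)
qed

lemma vertex_sum_dvd:
  assumes g: "g permutes {1..4}" shows "4 dvd vertex_sum g $ a $ b"
proof -
  have pm: "tetra_vertex i $ c = 1 \<or> tetra_vertex i $ c = -1" for i c
    using exhaust_3[of c] by (auto simp: tetra_vertex_def)
  have "4 dvd (1 + tetra_vertex (g i) $ a) * (1 + tetra_vertex i $ b)" for i
    using pm[of "g i" a] pm[of i b] by auto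
  then have "4 dvd (\<Sum>i\<in>{1..4}. (1 + tetra_vertex (g i) $ a) * (1 + tetra_vertex i $ b))"
    by (rule dvd_sum)
  also have "\<dots> = 4 + (\<Sum>i\<in>{1..4}. tetra_vertex (g i) $ a) + (\<Sum>i\<in>{1..4}. tetra_vertex i $ b) + vertex_sum g $ a $ b"
    by (simp add: vertex_sum_def algebra_simps sum.distrib)
  also have "(\<Sum>i\<in>{1..4}. tetra_vertex (g i) $ a) = 0"
    using sum.permute[OF g, of "\<lambda>i. tetra_vertex i $ a"] tetra_vertex_sum_zero[of a] by (simp add: o_def)
  finally show ?thesis using tetra_vertex_sum_zero[of b] by presburger
qed

lemma tR4: "g permutes {1..4} \<Longrightarrow> 4 * tetra_matrix g $ a $ b = vertex_sum g $ a $ b"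
  using vertex_sum_dvd[of g a b] by (simp add: tetra_matrix_def)

lemma tetra_matrix_mult:
  assumes g: "g permutes {1..4}" and h: "h permutes {1..4}"
  shows "tetra_matrix (g \<circ> h) = tetra_matrix g ** tetra_matrix h"
proof -
  have gh: "g \<circ> h permutes {1..4}" using g h permutes_compose by blast
  have "16 * (tetra_matrix g ** tetra_matrix h) $ a $ b = 16 * tetra_matrix (g \<circ> h) $ a $ b" for a b
  proof -
    have "16 * (tetra_matrix g ** tetra_matrix h) $ a $ b = (\<Sum>c\<in>UNIV. (4 * tetra_matrix g $ a $ c) * (4 * tetra_matrix h $ c $ b))"
      by (simp add: matrix_matrix_mult_def sum_distrib_left)
    also have "\<dots> = (vertex_sum g ** vertex_sum h) $ a $ b"
      by (simp only: tR4 g h) (simp add: matrix_matrix_mult_def)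
    also have "\<dots> = 4 * (4 * tetra_matrix (g \<circ> h) $ a $ b)" by (simp only: vertex_sum_mult g h tR4 gh)
    finally show ?thesis by simp
  qed
  then show ?thesis by (simp add: vec_eq_iff)
qed

lemma vertex_sum_val: "vertex_sum g $ a $ b = tetra_vertex (g 1) $ a * tetra_vertex 1 $ b + tetra_vertex (g 2) $ a * tetra_vertex 2 $ b + tetra_vertex (g 3) $ a * tetra_vertex 3 $ b
   + tetra_vertex (g 4) $ a * tetra_vertex 4 $ b"
  unfolding vertex_sum_def atLeastAtMost_1_4 by simp

lemma tetra_vertex_simps: "tetra_vertex 1 = vector [-1,-1,-1]" "tetra_vertex 2 = vector [-1,1,1]" "tetra_vertex 3 = vector [1,-1,1]" "tetra_vertex 4 = vector [1,1,-1]"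
  by (simp_all add: tetra_vertex_def)

lemma tetra_matrix_val: "tetra_matrix g = (\<chi> a b. (tetra_vertex (g 1) $ a * tetra_vertex 1 $ b + tetra_vertex (g 2) $ a * tetra_vertex 2 $ b + tetra_vertex (g 3) $ a * tetra_vertex 3 $ b
   + tetra_vertex (g 4) $ a * tetra_vertex 4 $ b) div 4)"
  unfolding tetra_matrix_def vertex_sum_val ..

lemma tetra_matrix_id: "tetra_matrix id = mat 1"
  unfolding tetra_matrix_val id_apply tetra_vertex_simps by (simp add: vec_eq_iff forall_3 mat_def)

lemma g_values: "g1 1 = 2" "g1 2 = 3" "g1 3 = 1" "g1 4 = 4"
  "g2 1 = 2" "g2 2 = 1" "g2 3 = 4" "g2 4 = 3"
  "g3 1 = 3" "g3 2 = 4" "g3 3 = 1" "g3 4 = 2"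
  by (simp_all add: g1_def g2_def g3_def Transposition.transpose_def)

lemma A4_representation_exists: "\<exists>\<rho>. A4_representation \<rho>"
proof (rule exI[of _ tetra_matrix], unfold A4_representation_def, intro conjI)
  have inv: "invertible (tetra_matrix g)" if g: "g permutes {1..4}" for g
  proof -
    have "tetra_matrix g ** tetra_matrix (inv' g) = mat 1" "tetra_matrix (inv' g) ** tetra_matrix g = mat 1"
      using tetra_matrix_mult[OF g permutes_inv[OF g]] tetra_matrix_mult[OF permutes_inv[OF g] g]
        permutes_inv_o[OF g] tetra_matrix_id by auto
    then show ?thesis unfolding invertible_def by blast
  qed
  show "tetra_matrix \<in> hom A4 GL3Z"
    by (rule homI) (auto simp: alt_group_carrier alt_group_mult GL3Z_def inv tetra_matrix_mult)

  show "tetra_matrix g1 = vector [vector [0, 1, 0], vector [0, 0, -1], vector [-1, 0, 0]]"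
    unfolding tetra_matrix_val g_values tetra_vertex_simps by (simp add: vec_eq_iff forall_3)
  show "tetra_matrix g2 = vector [vector [1, 0, 0], vector [0, -1, 0], vector [0, 0, -1]]"
    unfolding tetra_matrix_val g_values tetra_vertex_simps by (simp add: vec_eq_iff forall_3)
  show "tetra_matrix g3 = vector [vector [-1, 0, 0], vector [0, 1, 0], vector [0, 0, -1]]"
    unfolding tetra_matrix_val g_values tetra_vertex_simps by (simp add: vec_eq_iff forall_3)
qed


section \<open>The struts of the tensegrity\<close>

definition p0 :: "real \<Rightarrow> real \<Rightarrow> real^3" where
  "p0 x y = vector
     [- 2*x*y + 3*y^2 - 6*x + 2*y + 3,
      - 4*x^2 - 4*x*y + 3*y^2 + 4*x + 10*y + 3,
      4*x^2 - 3*y^2 - 4*x + 3]"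

definition node :: "((nat \<Rightarrow> nat) \<Rightarrow> int^3^3) \<Rightarrow> real \<Rightarrow> real \<Rightarrow> (nat \<Rightarrow> nat) \<Rightarrow> real^3" where
  "node \<rho> x y g = map_matrix real_of_int (\<rho> g) *v p0 x y"

definition strut ::
  "((nat \<Rightarrow> nat) \<Rightarrow> int^3^3) \<Rightarrow> real \<Rightarrow> real \<Rightarrow> (nat \<Rightarrow> nat) \<Rightarrow> (real^3) set" where
  "strut \<rho> x y g = closed_segment (node \<rho> x y g) (node \<rho> x y (g \<otimes>\<^bsub>A4\<^esub> g1))"

text \<open>
  For a left coset \<open>C = {g, g s, g s\<^sup>2}\<close> of the subgroup generated by \<open>s =\<close> \<^term>\<open>g1\<close>, the struts
  starting at the elements of \<open>C\<close> are the three sides of its triangle, because \<open>s\<close> has order 3.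
\<close>

definition strut_triangle ::
  "((nat \<Rightarrow> nat) \<Rightarrow> int^3^3) \<Rightarrow> real \<Rightarrow> real \<Rightarrow> (nat \<Rightarrow> nat) set \<Rightarrow> (real^3) set" where
  "strut_triangle \<rho> x y C = (\<Union>g\<in>C. strut \<rho> x y g)"

definition strut_triangles ::
  "((nat \<Rightarrow> nat) \<Rightarrow> int^3^3) \<Rightarrow> real \<Rightarrow> real \<Rightarrow> (real^3) set set" where
  "strut_triangles \<rho> x y = strut_triangle \<rho> x y ` (lcosets\<^bsub>A4\<^esub> (generate A4 {g1}))"

end

theory Submission
  imports Defs
begin

text \<open>
  The four strut triangles are the images of one triangle \<open>T\<close>, the orbit of \<open>p0 x y\<close> under the rotation
  \<open>rot3\<close> of order three, under the rotations of a tetrahedron. Every element of the alternating group outside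
  the subgroup generated by \<open>g1\<close> is of the form \<open>s g2 t\<close> with \<open>s, t\<close> in that subgroup, and the subgroup
  preserves \<open>T\<close>. Every pair of strut triangles is therefore a rotated copy of the single pair that consists
  of \<open>T\<close> and its half-turn around the first coordinate axis (\<open>rotated_triangles_hopf\<close>).

  The planes of these two triangles meet in a line, which each triangle crosses in two points. If the two pairs
  of points are interleaved, the triangles form a Hopf link (\<open>interleaved_hopf_link\<close>).
  A deformation of one plane that fixes the common line extends to space without moving the other plane, so
  the two triangles can be made round independently. The deformations are explicit: linear maps, piecewise linear
  stretchings of the common line, and maps that rescale each ray from a point inside a curve. Each of them is
  joined to the identity by a straight-line homotopy through homeomorphisms, or is composed of such maps.

  Because the half-turn reverses the common line around a fixed point on it, the two pairs of points are
  interleaved precisely when that point lies inside \<open>T\<close> and is not the midpoint of the chord of \<open>T\<close>. For the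
  coordinates of \<open>p0 x y\<close> this is a short list of polynomial inequalities (\<open>p0_inequalities\<close>), and the kernel
  relations of the stress matrix reduce it to quadratic forms in two variables.
\<close>

section \<open>Maps isotopic to the identity\<close>

text \<open>
  The maps at which an ambient isotopy can end. Working with maps instead of the relation between
  sets shows what a single deformation does to each component of a link, and such maps can be composed.
\<close>
definition isotopic_to_id :: "('a::topological_space \<Rightarrow> 'a) \<Rightarrow> bool" where
  "isotopic_to_id F \<longleftrightarrow>
     (\<exists>H :: real \<Rightarrow> 'a \<Rightarrow> 'a.
        continuous_on ({0..1} \<times> UNIV) (\<lambda>(t, z). H t z) \<and>
        (\<forall>t\<in>{0..1}. \<exists>G. homeomorphism UNIV UNIV (H t) G) \<and>
        (\<forall>z. H 0 z = z) \<and> H 1 = F)"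

lemma ambient_isotopic_iff: "ambient_isotopic A B \<longleftrightarrow> (\<exists>F. isotopic_to_id F \<and> F ` A = B)"
  unfolding ambient_isotopic_def isotopic_to_id_def by blast

lemma isotopic_to_id_homeomorphism:
  assumes "isotopic_to_id F"
  obtains G where "homeomorphism UNIV UNIV F G"
  using assms unfolding isotopic_to_id_def by (meson atLeastAtMost_iff order_refl zero_le_one)

text \<open>
  Continuity of the inverses is invariance of domain, so that an isotopy of a Euclidean space
  only has to be jointly continuous and bijective at every time.
\<close>
lemma isotopic_to_idI:
  fixes H :: "real \<Rightarrow> 'a::euclidean_space \<Rightarrow> 'a"
  assumes cont: "continuous_on ({0..1} \<times> UNIV) (\<lambda>(t, z). H t z)"
    and bij: "\<And>t. t \<in> {0..1} \<Longrightarrow> bij (H t)"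
    and "\<And>z. H 0 z = z" and "H 1 = F"
  shows "isotopic_to_id F"
  unfolding isotopic_to_id_def
proof (intro exI[of _ H] conjI ballI)
  fix t :: real assume t: "t \<in> {0..1}"
  have "continuous_on UNIV (\<lambda>z. case (t, z) of (t, z) \<Rightarrow> H t z)"
    by (rule continuous_on_compose2[OF cont]) (use t in \<open>auto intro!: continuous_intros\<close>)
  then have "continuous_on UNIV (H t)" by simp
  then obtain G where "homeomorphism UNIV (H t ` UNIV) (H t) G"
    using invariance_of_domain_homeomorphism[of UNIV "H t"] bij[OF t]
    by (metis bij_is_inj open_UNIV order_refl)
  then show "\<exists>G. homeomorphism UNIV UNIV (H t) G"
    using bij[OF t] by (metis bij_is_surj)
qed (use assms in auto)

lemma isotopic_to_id_id: "isotopic_to_id (\<lambda>z. z)"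
  unfolding isotopic_to_id_def
  by (rule exI[of _ "\<lambda>t z. z"])
    (auto simp: split_beta intro!: continuous_intros homeomorphism_ident)

lemma isotopic_to_id_comp:
  assumes "isotopic_to_id F" "isotopic_to_id G"
  shows "isotopic_to_id (F \<circ> G)"
proof -
  obtain H where H: "continuous_on ({0..1} \<times> UNIV) (\<lambda>(t, z). H t z)"
    "\<forall>t\<in>{0..1::real}. \<exists>G. homeomorphism UNIV UNIV (H t) G" "\<forall>z. H 0 z = z" "H 1 = F"
    using assms(1) unfolding isotopic_to_id_def by metis
  obtain K where K: "continuous_on ({0..1} \<times> UNIV) (\<lambda>(t, z). K t z)"
    "\<forall>t\<in>{0..1::real}. \<exists>G. homeomorphism UNIV UNIV (K t) G" "\<forall>z. K 0 z = z" "K 1 = G"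
    using assms(2) unfolding isotopic_to_id_def by metis
  show ?thesis
    unfolding isotopic_to_id_def
  proof (intro exI[of _ "\<lambda>t. H t \<circ> K t"] conjI ballI)
    have "continuous_on ({0..1} \<times> UNIV) (\<lambda>p. (fst p, case p of (t, z) \<Rightarrow> K t z))"
      by (intro continuous_intros K(1))
    then have "continuous_on ({0..1} \<times> UNIV)
        (\<lambda>p. case (fst p, case p of (t, z) \<Rightarrow> K t z) of (t, z) \<Rightarrow> H t z)"
      by (rule continuous_on_compose2[OF H(1)]) auto
    then show "continuous_on ({0..1} \<times> UNIV) (\<lambda>(t, z). (H t \<circ> K t) z)"
      by (simp add: split_beta)
    show "\<exists>G. homeomorphism UNIV UNIV (H t \<circ> K t) G" if "t \<in> {0..1}" for t
      using that H(2) K(2) homeomorphism_compose by metis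
  qed (use H K in auto)
qed

text \<open>
  Conjugation and products extend isotopies of a line or a plane to all of space:
  space is split into the line or plane and a complement, which is left fixed.
\<close>
lemma isotopic_to_id_conj:
  assumes F: "isotopic_to_id F" and ij: "homeomorphism UNIV UNIV i j"
  shows "isotopic_to_id (j \<circ> F \<circ> i)"
proof -
  obtain H where H: "continuous_on ({0..1} \<times> UNIV) (\<lambda>(t, z). H t z)"
    "\<forall>t\<in>{0..1::real}. \<exists>G. homeomorphism UNIV UNIV (H t) G" "\<forall>z. H 0 z = z" "H 1 = F"
    using assms(1) unfolding isotopic_to_id_def by metis
  have i: "continuous_on UNIV i" and j: "continuous_on UNIV j" and ji: "\<And>z. j (i z) = z"
    using ij by (auto simp: homeomorphism_def)
  show ?thesis
    unfolding isotopic_to_id_def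
  proof (intro exI[of _ "\<lambda>t. j \<circ> H t \<circ> i"] conjI ballI)
    have "continuous_on ({0..1} \<times> UNIV) (\<lambda>p. (fst p, i (snd p)))"
      by (intro continuous_intros continuous_on_compose2[OF i]) auto
    then have "continuous_on ({0..1} \<times> UNIV) (\<lambda>p. case (fst p, i (snd p)) of (t, z) \<Rightarrow> H t z)"
      by (rule continuous_on_compose2[OF H(1)]) auto
    then have "continuous_on ({0..1} \<times> UNIV) (\<lambda>p. j (case (fst p, i (snd p)) of (t, z) \<Rightarrow> H t z))"
      by (rule continuous_on_compose2[OF j]) auto
    then show "continuous_on ({0..1} \<times> UNIV) (\<lambda>(t, z). (j \<circ> H t \<circ> i) z)"
      by (simp add: split_beta)
    show "\<exists>G. homeomorphism UNIV UNIV (j \<circ> H t \<circ> i) G" if t: "t \<in> {0..1}" for t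
    proof -
      obtain G where "homeomorphism UNIV UNIV (H t) G" using t H(2) by blast
      then show ?thesis
        using homeomorphism_compose[OF homeomorphism_compose[OF ij]] homeomorphism_symD[OF ij]
        by (metis comp_assoc)
    qed
  qed (use H ji in auto)
qed

lemma isotopic_to_id_prod:
  assumes "isotopic_to_id (F :: 'a::topological_space \<Rightarrow> 'a)"
  shows "isotopic_to_id (map_prod F (id :: 'b::topological_space \<Rightarrow> 'b))"
proof -
  obtain H where H: "continuous_on ({0..1} \<times> UNIV) (\<lambda>(t, z). H t z)"
    "\<forall>t\<in>{0..1::real}. \<exists>G. homeomorphism UNIV UNIV (H t) G" "\<forall>z. H 0 z = z" "H 1 = F"
    using assms(1) unfolding isotopic_to_id_def by metis
  show ?thesis
    unfolding isotopic_to_id_def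
  proof (intro exI[of _ "\<lambda>t. map_prod (H t) (id :: 'b \<Rightarrow> 'b)"] conjI ballI)
    have "continuous_on ({0..1} \<times> UNIV) (\<lambda>p::real \<times> 'a \<times> 'b. (fst p, fst (snd p)))"
      by (intro continuous_intros)
    then have "continuous_on ({0..1} \<times> UNIV)
        (\<lambda>p::real \<times> 'a \<times> 'b. case (fst p, fst (snd p)) of (t, z) \<Rightarrow> H t z)"
      by (rule continuous_on_compose2[OF H(1)]) auto
    then have "continuous_on ({0..1} \<times> UNIV)
        (\<lambda>p::real \<times> 'a \<times> 'b. (case (fst p, fst (snd p)) of (t, z) \<Rightarrow> H t z, snd (snd p)))"
      by (intro continuous_intros)
    then show "continuous_on ({0..1} \<times> UNIV) (\<lambda>(t, z). map_prod (H t) (id :: 'b \<Rightarrow> 'b) z)"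
      by (simp add: split_beta map_prod_def)
    show "\<exists>G. homeomorphism UNIV UNIV (map_prod (H t) (id :: 'b \<Rightarrow> 'b)) G" if t: "t \<in> {0..1}" for t
    proof -
      obtain G where G: "homeomorphism UNIV UNIV (H t) G" using t H(2) by blast
      then have c: "continuous_on UNIV (H t)" "continuous_on UNIV G"
        and e: "\<And>z. G (H t z) = z" "\<And>z. H t (G z) = z"
        by (auto simp: homeomorphism_def)
      have "homeomorphism UNIV UNIV (map_prod (H t) (id :: 'b \<Rightarrow> 'b)) (map_prod G id)"
        unfolding map_prod_def split_beta
        by (rule homeomorphismI)
          (auto simp: e intro!: continuous_intros continuous_on_compose2[OF c(1)] continuous_on_compose2[OF c(2)])
      then show ?thesis by blast
    qed
  qed (use H in auto)
qed

lemma simple_closed_curve_image: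
  assumes "simple_closed_curve A" "continuous_on A f" "inj_on f A"
  shows "simple_closed_curve (f ` A)"
proof -
  obtain \<gamma> where \<gamma>: "simple_path \<gamma>" "pathfinish \<gamma> = pathstart \<gamma>" "path_image \<gamma> = A"
    using assms(1) unfolding simple_closed_curve_def by blast
  have "simple_path (f \<circ> \<gamma>)"
    using simple_path_continuous_image \<gamma> assms(2,3) by metis
  moreover have "pathfinish (f \<circ> \<gamma>) = pathstart (f \<circ> \<gamma>)"
    using \<gamma>(2) by (simp add: pathfinish_def pathstart_def)
  moreover have "path_image (f \<circ> \<gamma>) = f ` A"
    using \<gamma>(3) by (metis path_image_compose)
  ultimately show ?thesis unfolding simple_closed_curve_def by blast
qed

text \<open>
  Every condition in the definition of a Hopf link pulls back along a homeomorphism, and isotopies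
  compose. Hence a link may be simplified step by step by maps isotopic to the identity.
\<close>
lemma forms_hopf_link_image:
  assumes F: "isotopic_to_id F" and link: "forms_hopf_link (F ` A) (F ` B)"
  shows "forms_hopf_link A B"
proof -
  obtain G where G: "homeomorphism UNIV UNIV F G"
    using isotopic_to_id_homeomorphism[OF F] .
  then have e: "G ` F ` C = C" for C by (force simp: homeomorphism_def image_image)
  have "continuous_on C G" "inj_on G C" for C
    using G by (auto simp: homeomorphism_def intro: inj_on_inverseI continuous_on_subset)
  then have "simple_closed_curve C" if "simple_closed_curve (F ` C)" for C
    using simple_closed_curve_image[OF that] e by metis
  moreover have "A \<inter> B = {}" using link unfolding forms_hopf_link_def by blast
  moreover obtain F' where "isotopic_to_id F'" "F' ` (F ` A \<union> F ` B) = standard_hopf_link"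
    using link unfolding forms_hopf_link_def ambient_isotopic_iff by blast
  then have "isotopic_to_id (F' \<circ> F)" "(F' \<circ> F) ` (A \<union> B) = standard_hopf_link"
    using isotopic_to_id_comp F by (auto simp: image_comp[symmetric] image_Un)
  then have "ambient_isotopic (A \<union> B) standard_hopf_link" unfolding ambient_isotopic_iff by blast
  ultimately show ?thesis using link unfolding forms_hopf_link_def by blast
qed

section \<open>Affine and piecewise linear maps isotopic to the identity\<close>

lemma isotopic_to_id_translation: "isotopic_to_id (\<lambda>z::'a::euclidean_space. v + z)"
proof (rule isotopic_to_idI[where H = "\<lambda>t z. t *\<^sub>R v + z"])
  show "bij (\<lambda>z. t *\<^sub>R v + z)" for t by (rule bij_plus)
qed (auto simp: split_beta intro!: continuous_intros)

text \<open>
  The straight segment from the identity matrix to \<open>A\<close> is an isotopy if it avoids the singular matrices.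
\<close>
lemma isotopic_to_id_matrix:
  fixes A :: "real^'n^'n"
  assumes "\<And>t. 0 \<le> t \<Longrightarrow> t \<le> 1 \<Longrightarrow> det ((1 - t) *\<^sub>R mat 1 + t *\<^sub>R A) \<noteq> 0"
  shows "isotopic_to_id ((*v) A)"
proof (rule isotopic_to_idI[where H = "\<lambda>t z. (1 - t) *\<^sub>R z + t *\<^sub>R (A *v z)"])
  show "bij (\<lambda>z. (1 - t) *\<^sub>R z + t *\<^sub>R (A *v z))" if "t \<in> {0..1}" for t
  proof -
    let ?B = "(1 - t) *\<^sub>R mat 1 + t *\<^sub>R A"
    have eq: "(\<lambda>z. (1 - t) *\<^sub>R z + t *\<^sub>R (A *v z)) = (*v) ?B"
      by (rule ext) (simp add: matrix_vector_mult_add_rdistrib scaleR_matrix_vector_assoc[symmetric])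
    have "invertible ?B" using assms[of t] that by (simp add: invertible_det_nz)
    then show ?thesis unfolding eq by (metis invertible_eq_bij)
  qed
  have c: "continuous_on S (\<lambda>p. A *v snd p)" for S :: "(real \<times> (real^'n)) set"
    by (rule continuous_on_compose2[OF matrix_vector_mult_linear_continuous_on]) (auto intro!: continuous_intros)
  show "continuous_on ({0..1} \<times> UNIV) (\<lambda>(t, z). (1 - t) *\<^sub>R z + t *\<^sub>R (A *v z))"
    unfolding split_beta by (intro continuous_intros c)
qed auto

text \<open>
  An expanding function exceeds every bound in both directions; surjectivity is then the
  intermediate value theorem.
\<close>
lemma bij_expanding:
  fixes f :: "real \<Rightarrow> real"
  assumes cont: "continuous_on UNIV f" and k: "0 < k"
    and exp: "\<And>x y. y \<le> x \<Longrightarrow> k * (x - y) \<le> f x - f y"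
  shows "bij f"
proof (rule bijI)
  show "inj f"
  proof (rule linorder_injI)
    fix x y :: real assume "x < y"
    then have "0 < k * (y - x)" using k by simp
    then show "f x \<noteq> f y" using exp[of x y] \<open>x < y\<close> by simp
  qed
  show "surj f"
    unfolding surj_def
  proof
    fix w
    define R where "R = \<bar>w - f 0\<bar> / k"
    have R: "0 \<le> R" "k * R = \<bar>w - f 0\<bar>" using k by (auto simp: R_def)
    have "f (- R) \<le> w" "w \<le> f R" using exp[of "- R" 0] exp[of 0 R] R by auto
    moreover have "continuous_on {- R..R} f" using cont continuous_on_subset by blast
    ultimately show "\<exists>x. w = f x" using IVT'[of f "- R" w R] R by auto
  qed
qed

text \<open>
  Convex combinations with the identity are again expanding, hence bijective.
\<close>
lemma isotopic_to_id_expanding: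
  fixes f :: "real \<Rightarrow> real"
  assumes cont: "continuous_on UNIV f" and k: "0 < k"
    and exp: "\<And>x y. y \<le> x \<Longrightarrow> k * (x - y) \<le> f x - f y"
  shows "isotopic_to_id f"
proof (rule isotopic_to_idI[where H = "\<lambda>t x. (1 - t) * x + t * f x"])
  show "bij (\<lambda>x. (1 - t) * x + t * f x)" if t: "t \<in> {0..1}" for t
  proof (rule bij_expanding)
    show "continuous_on UNIV (\<lambda>x. (1 - t) * x + t * f x)" by (intro continuous_intros cont)
    show "0 < min 1 k" using k by simp
    fix x y :: real assume xy: "y \<le> x"
    have "min 1 k * (x - y) \<le> k * (x - y)" "min 1 k * (x - y) \<le> 1 * (x - y)"
      using xy by (intro mult_right_mono; simp)+
    then have "(1 - t) * (min 1 k * (x - y)) + t * (min 1 k * (x - y)) \<le> (1 - t) * (x - y) + t * (f x - f y)"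
      using t exp[OF xy] by (intro add_mono mult_left_mono) auto
    then show "min 1 k * (x - y) \<le> ((1 - t) * x + t * f x) - ((1 - t) * y + t * f y)"
      by (simp add: algebra_simps)
  qed
  show "continuous_on ({0..1} \<times> UNIV) (\<lambda>(t, x). (1 - t) * x + t * f x)"
    unfolding split_beta by (intro continuous_intros continuous_on_compose2[OF cont]) auto
qed auto

text \<open>
  The function is piecewise linear with breaks at \<open>b\<close> and \<open>c\<close>. It is written as a sum of three
  functions, each of which varies on one of the pieces only, with the slope of that piece.
\<close>
lemma stretch_four_points:
  fixes a b c d :: real
  assumes "a < b" "b < c" "c < d" "a' < b'" "b' < c'" "c' < d'"
  obtains f where "isotopic_to_id f" "strict_mono f" "surj f" "f a = a'" "f b = b'" "f c = c'" "f d = d'"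
proof -
  define k1 k2 k3 where "k1 = (b' - a') / (b - a)" and "k2 = (c' - b') / (c - b)" and "k3 = (d' - c') / (d - c)"
  have k: "0 < k1" "0 < k2" "0 < k3" using assms by (auto simp: k1_def k2_def k3_def)
  have e: "k1 * (b - a) = b' - a'" "k2 * (c - b) = c' - b'" "k3 * (d - c) = d' - c'"
    using assms by (auto simp: k1_def k2_def k3_def)
  define f where "f = (\<lambda>x. a' + k1 * (min x b - a) + k2 * (min (max x b) c - b) + k3 * (max x c - c))"
  define k where "k = min k1 (min k2 k3)"
  have k0: "0 < k" "k \<le> k1" "k \<le> k2" "k \<le> k3" using k by (auto simp: k_def)
  have cont: "continuous_on UNIV f" unfolding f_def by (intro continuous_intros)
  have exp: "k * (x - y) \<le> f x - f y" if "y \<le> x" for x y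
  proof -
    have "k * (min x b - min y b) \<le> k1 * (min x b - min y b)"
      "k * (min (max x b) c - min (max y b) c) \<le> k2 * (min (max x b) c - min (max y b) c)"
      "k * (max x c - max y c) \<le> k3 * (max x c - max y c)"
      using k0 that by (intro mult_right_mono; auto)+
    moreover have "x - y = (min x b - min y b) + (min (max x b) c - min (max y b) c) + (max x c - max y c)"
      using assms(2) by (auto simp: min_def max_def)
    then have "k * (x - y) = k * (min x b - min y b) + k * (min (max x b) c - min (max y b) c) + k * (max x c - max y c)"
      by (simp only: distrib_left)
    ultimately show ?thesis unfolding f_def by (simp add: algebra_simps)
  qed
  show thesis
  proof
    show "isotopic_to_id f" by (rule isotopic_to_id_expanding[OF cont k0(1) exp])
    show "surj f" using bij_expanding[OF cont k0(1) exp] bij_is_surj by blast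
    show "strict_mono f"
    proof (rule strict_monoI)
      fix x y :: real assume "x < y"
      then have "0 < k * (y - x)" using k0 by simp
      then show "f x < f y" using exp[of x y] \<open>x < y\<close> by simp
    qed
    show "f a = a'" "f b = b'" "f c = c'" "f d = d'" using assms e by (auto simp: f_def)
  qed
qed

section \<open>Radial maps between star-shaped curves\<close>

text \<open>
  The Minkowski gauge of a bounded region that is star-shaped around the origin and has a continuous
  boundary; the boundary is the level set of 1.
\<close>
definition star_gauge :: "('a::euclidean_space \<Rightarrow> real) \<Rightarrow> bool" where
  "star_gauge g \<longleftrightarrow> continuous_on UNIV g \<and> (\<forall>p. p \<noteq> 0 \<longrightarrow> 0 < g p) \<and>
     (\<forall>c p. 0 \<le> c \<longrightarrow> g (c *\<^sub>R p) = c * g p)"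

lemma star_gaugeD:
  assumes "star_gauge g"
  shows "continuous_on S g" "p \<noteq> 0 \<Longrightarrow> 0 < g p" "0 \<le> c \<Longrightarrow> g (c *\<^sub>R p) = c * g p" "g 0 = 0"
proof -
  show "continuous_on S g" using assms continuous_on_subset unfolding star_gauge_def by blast
  show h: "g (c *\<^sub>R p) = c * g p" if "0 \<le> c" for c p using assms that unfolding star_gauge_def by blast
  show "g 0 = 0" using h[of 0 0] by simp
qed (use assms in \<open>auto simp: star_gauge_def\<close>)

lemma star_gauge_norm: "star_gauge (norm :: 'a::euclidean_space \<Rightarrow> real)"
  unfolding star_gauge_def by (auto intro!: continuous_intros)

text \<open>
  By compactness of the unit sphere and homogeneity. The bound makes radial maps continuous at the origin.
\<close>
lemma star_gauge_lower_bound: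
  assumes "star_gauge (g :: 'a::euclidean_space \<Rightarrow> real)"
  obtains k where "0 < k" "\<And>p. k * norm p \<le> g p"
proof -
  have "sphere (0::'a) 1 \<noteq> {}" by simp
  then obtain q :: 'a where q: "q \<in> sphere 0 1" "\<And>p. p \<in> sphere 0 1 \<Longrightarrow> g q \<le> g p"
    using continuous_attains_inf[OF compact_sphere _ star_gaugeD(1)[OF assms], of 0 1] by blast
  show thesis
  proof (rule that[of "g q"])
    have "q \<noteq> 0" using q(1) by auto
    then show "0 < g q" by (rule star_gaugeD(2)[OF assms])
    show "g q * norm p \<le> g p" for p
    proof (cases "p = 0")
      case False
      then have "g q \<le> g ((1 / norm p) *\<^sub>R p)" by (intro q(2)) simp
      also have "\<dots> = g p / norm p" by (simp add: star_gaugeD(3)[OF assms])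
      finally show ?thesis using False by (simp add: field_simps)
    qed (simp add: star_gaugeD(4)[OF assms])
  qed
qed

definition radial :: "('a::euclidean_space \<Rightarrow> real) \<Rightarrow> ('a \<Rightarrow> real) \<Rightarrow> 'a \<Rightarrow> 'a" where
  "radial g h p = (g p / h p) *\<^sub>R p"

lemma continuous_on_radial:
  assumes g: "star_gauge g" and h: "star_gauge h"
  shows "continuous_on UNIV (radial g h)"
proof -
  obtain k where k: "0 < k" "\<And>p. k * norm p \<le> h p" using star_gauge_lower_bound[OF h] by blast
  have "isCont (radial g h) p" for p
  proof (cases "p = 0")
    case False
    have "isCont g p" "isCont h p"
      using star_gaugeD(1)[OF g, of UNIV] star_gaugeD(1)[OF h, of UNIV] by (simp_all add: continuous_on_eq_continuous_at)
    moreover have "h p \<noteq> 0" using star_gaugeD(2)[OF h False] by simp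
    ultimately show ?thesis unfolding radial_def by (intro continuous_intros)
  next
    case True
    have lim: "((\<lambda>p. g p / k) \<longlongrightarrow> 0) (at 0)"
    proof -
      have "(g \<longlongrightarrow> g 0) (at 0)"
        using star_gaugeD(1)[OF g, of UNIV] by (simp add: continuous_on_eq_continuous_at isCont_def)
      from tendsto_divide[OF this tendsto_const[of k]] show ?thesis
        using k star_gaugeD(4)[OF g] by simp
    qed
    have bound: "norm (radial g h p) \<le> g p / k" for p
    proof (cases "p = 0")
      case False
      have pos: "0 < g p" "0 < h p" using star_gaugeD(2) g h False by blast+
      have "norm (radial g h p) = g p * (norm p / h p)" using pos by (simp add: radial_def)
      also have "norm p / h p \<le> 1 / k" using k(1) k(2)[of p] pos by (simp add: field_simps)
      finally show ?thesis using pos by (simp add: mult_left_mono)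
    qed (simp add: radial_def star_gaugeD(4)[OF g])
    have "(radial g h \<longlongrightarrow> 0) (at 0)"
      by (rule Lim_null_comparison[OF _ lim]) (simp add: bound)
    then show ?thesis using True by (simp add: isCont_def radial_def)
  qed
  then show ?thesis by (simp add: continuous_on_eq_continuous_at)
qed

text \<open>
  A radial map multiplies every open ray from the origin by a positive constant. The same is true of
  its convex combinations with the identity, so the straight-line homotopy consists of bijections.
\<close>
lemma isotopic_to_id_radial:
  assumes g: "star_gauge g" and h: "star_gauge h"
  shows "isotopic_to_id (radial g h)"
proof (rule isotopic_to_idI[where H = "\<lambda>t p. (1 - t) *\<^sub>R p + t *\<^sub>R radial g h p"])
  show "continuous_on ({0..1} \<times> UNIV) (\<lambda>(t, p). (1 - t) *\<^sub>R p + t *\<^sub>R radial g h p)"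
    unfolding split_beta
    by (intro continuous_intros continuous_on_compose2[OF continuous_on_radial[OF g h]]) auto
  fix t :: real assume t: "t \<in> {0..1}"
  define \<mu> where "\<mu> p = (1 - t) + t * (g p / h p)" for p
  have eq: "(\<lambda>p. (1 - t) *\<^sub>R p + t *\<^sub>R radial g h p) = (\<lambda>p. \<mu> p *\<^sub>R p)"
    by (rule ext) (simp add: \<mu>_def radial_def algebra_simps)
  have pos: "0 < \<mu> p" if "p \<noteq> 0" for p
  proof -
    have "0 < g p / h p" using star_gaugeD(2)[OF g that] star_gaugeD(2)[OF h that] by simp
    then have "0 < t * (g p / h p)" if "t \<noteq> 0" using t that by (intro mult_pos_pos) auto
    then show ?thesis using t unfolding \<mu>_def
      by (cases "t = 0") (auto intro: add_nonneg_pos simp del: times_divide_eq_right)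
  qed
  have scale: "\<mu> (c *\<^sub>R p) = \<mu> p" if "0 < c" for c p
    using that by (simp add: \<mu>_def star_gaugeD(3)[OF g] star_gaugeD(3)[OF h])
  show "bij (\<lambda>p. (1 - t) *\<^sub>R p + t *\<^sub>R radial g h p)"
    unfolding eq
  proof (rule bijI)
    show "inj (\<lambda>p. \<mu> p *\<^sub>R p)"
    proof (rule injI)
      fix p q assume e: "\<mu> p *\<^sub>R p = \<mu> q *\<^sub>R q"
      show "p = q"
      proof (cases "p = 0 \<or> q = 0")
        case True
        then show ?thesis using e pos by (metis less_irrefl scaleR_eq_0_iff)
      next
        case False
        then have pq: "0 < \<mu> p" "0 < \<mu> q" using pos by auto
        have "q = (1 / \<mu> q) *\<^sub>R (\<mu> q *\<^sub>R q)" using pq by simp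
        also have "\<dots> = (\<mu> p / \<mu> q) *\<^sub>R p" by (simp add: e[symmetric])
        finally have "q = (\<mu> p / \<mu> q) *\<^sub>R p" .
        then have same: "\<mu> q = \<mu> p" using scale pq by (metis divide_pos_pos)
        from e have "\<mu> p *\<^sub>R p = \<mu> p *\<^sub>R q" by (simp only: same)
        then show ?thesis using pq(1) by (metis less_irrefl scaleR_left_imp_eq)
      qed
    qed
    show "surj (\<lambda>p. \<mu> p *\<^sub>R p)"
      unfolding surj_def
    proof
      fix q
      show "\<exists>p. q = \<mu> p *\<^sub>R p"
      proof (cases "q = 0")
        case False
        then have "0 < \<mu> q" by (rule pos)
        then have "q = \<mu> ((1 / \<mu> q) *\<^sub>R q) *\<^sub>R ((1 / \<mu> q) *\<^sub>R q)" by (simp add: scale)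
        then show ?thesis by blast
      qed (intro exI[of _ 0], simp)
    qed
  qed
qed auto

lemma radial_level_set:
  assumes g: "star_gauge g" and h: "star_gauge h"
  shows "radial g h ` {p. g p = 1} = {p. h p = 1}"
proof (intro equalityI subsetI)
  fix q assume "q \<in> radial g h ` {p. g p = 1}"
  then obtain p where p: "g p = 1" "q = (1 / h p) *\<^sub>R p" by (auto simp: radial_def)
  then have "0 < h p" using star_gaugeD(4)[OF g] star_gaugeD(2)[OF h] by (metis zero_neq_one)
  then show "q \<in> {p. h p = 1}" using p by (simp add: star_gaugeD(3)[OF h])
next
  fix q assume q: "q \<in> {p. h p = 1}"
  then have "0 < g q" using star_gaugeD(4)[OF h] star_gaugeD(2)[OF g] by (metis mem_Collect_eq zero_neq_one)
  then have "q = radial g h ((1 / g q) *\<^sub>R q)" "g ((1 / g q) *\<^sub>R q) = 1"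
    using q by (simp_all add: radial_def star_gaugeD(3)[OF h] star_gaugeD(3)[OF g])
  then show "q \<in> radial g h ` {p. g p = 1}" by blast
qed

text \<open>
  The radial map of a plane, extended to space by the identity in the complementary direction. As the
  two gauges agree on the horizontal axis, the radial map fixes that axis, and so its extension fixes
  the whole orthogonal plane through it. This allows one component of a link to be
  reshaped in its own plane while the other component, lying in the orthogonal plane, does not move.
\<close>
lemma radial_lift:
  fixes i :: "'a::topological_space \<Rightarrow> (real \<times> real) \<times> 'b::{topological_space,zero}"
  assumes ij: "homeomorphism UNIV UNIV i j" and g: "star_gauge g" and h: "star_gauge h"
    and axis: "g (1, 0) = h (1, 0)" "g (-1, 0) = h (-1, 0)"
  obtains F where "isotopic_to_id F"
    "F ` {z. snd (i z) = 0 \<and> g (fst (i z)) = 1} = {z. snd (i z) = 0 \<and> h (fst (i z)) = 1}"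
    "\<And>z. snd (fst (i z)) = 0 \<Longrightarrow> F z = z"
proof -
  let ?F = "j \<circ> map_prod (radial g h) id \<circ> i"
  have e: "\<And>w. i (j w) = w" "\<And>z. j (i z) = z" using ij by (auto simp: homeomorphism_def)
  show thesis
  proof (rule that[of ?F])
    show "isotopic_to_id ?F"
      by (rule isotopic_to_id_conj[OF isotopic_to_id_prod[OF isotopic_to_id_radial[OF g h]] ij])
    show "?F ` {z. snd (i z) = 0 \<and> g (fst (i z)) = 1} = {z. snd (i z) = 0 \<and> h (fst (i z)) = 1}"
      (is "_ ` ?A = ?B")
    proof (intro equalityI subsetI)
      fix w assume "w \<in> ?F ` ?A"
      then obtain z where z: "snd (i z) = 0" "g (fst (i z)) = 1" "w = ?F z" by blast
      then show "w \<in> ?B" using radial_level_set[OF g h] by (auto simp: e)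
    next
      fix w assume "w \<in> ?B"
      then have w: "snd (i w) = 0" "h (fst (i w)) = 1" by auto
      then obtain p where p: "g p = 1" "fst (i w) = radial g h p"
        using radial_level_set[OF g h] by blast
      then have "i w = map_prod (radial g h) id (p, 0)" using w(1) by (simp add: prod_eq_iff)
      then have "w = ?F (j (p, 0))" by (simp only: o_def e) (metis e(2))
      moreover have "j (p, 0) \<in> ?A" using p(1) by (simp add: e)
      ultimately show "w \<in> ?F ` ?A" by blast
    qed
    \<comment> \<open>By homogeneity, agreement at both unit vectors gives agreement on the axis.\<close>
    have fix_axis: "radial g h (x, 0) = (x, 0)" for x
    proof -
      have "g (x, 0) = h (x, 0)"
      proof (cases "0 \<le> x")
        case True
        then show ?thesis
          using star_gaugeD(3)[OF g, of x "(1, 0)"] star_gaugeD(3)[OF h, of x "(1, 0)"] axis by simp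
      next
        case False
        then show ?thesis
          using star_gaugeD(3)[OF g, of "- x" "(-1, 0)"] star_gaugeD(3)[OF h, of "- x" "(-1, 0)"] axis
          by simp
      qed
      moreover have "0 < h (x, 0)" if "x \<noteq> 0" using that by (intro star_gaugeD(2)[OF h]) (simp add: zero_prod_def)
      ultimately show ?thesis by (cases "x = 0") (auto simp: radial_def)
    qed
    show "?F z = z" if "snd (fst (i z)) = 0" for z
    proof -
      have "map_prod (radial g h) id (i z) = i z"
        using that fix_axis[of "fst (fst (i z))"] by (metis id_apply map_prod_simp prod.collapse)
      then show ?thesis by (simp add: e)
    qed
  qed
qed

section \<open>Linked curves in two perpendicular planes\<close>

lemma continuous_on_vector_3 [continuous_intros]:
  assumes "continuous_on S f" "continuous_on S g" "continuous_on S h"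
  shows "continuous_on S (\<lambda>x. vector [f x, g x, h x] :: real^3)"
proof -
  have "(\<lambda>x. vector [f x, g x, h x] :: real^3) = (\<lambda>x. \<chi> i. if i = 1 then f x else if i = 2 then g x else h x)"
    by (rule ext) (auto simp: vec_eq_iff forall_3)
  moreover have "continuous_on S (\<lambda>x. if i = 1 then f x else if i = 2 then g x else h x)" for i :: 3
    using assms by (cases "i = 1"; cases "i = 2") simp_all
  ultimately show ?thesis by (simp only: continuous_on_vec_lambda)
qed

text \<open>
  The closed curve in the plane \<open>z = 0\<close> that is star-shaped around the point \<open>m\<close> of the first axis and
  has gauge \<open>g\<close> there; its analogue in the plane \<open>y = 0\<close> is \<open>curve_xz\<close>.
\<close>
definition curve_xy :: "real \<Rightarrow> (real \<times> real \<Rightarrow> real) \<Rightarrow> (real^3) set" where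
  "curve_xy m g = {z. z$3 = 0 \<and> g (z$1 - m, z$2) = 1}"

definition curve_xz :: "real \<Rightarrow> (real \<times> real \<Rightarrow> real) \<Rightarrow> (real^3) set" where
  "curve_xz m g = {z. z$2 = 0 \<and> g (z$1 - m, z$3) = 1}"

lemma change_gauge_xy:
  assumes "star_gauge g" "star_gauge h" "g (1, 0) = h (1, 0)" "g (-1, 0) = h (-1, 0)"
  obtains F where "isotopic_to_id F" "F ` curve_xy m g = curve_xy m h" "\<And>n k. F ` curve_xz n k = curve_xz n k"
proof -
  have ij: "homeomorphism UNIV UNIV (\<lambda>z::real^3. ((z$1 - m, z$2), z$3))
      (\<lambda>w. vector [fst (fst w) + m, snd (fst w), snd w])"
    by (rule homeomorphismI) (auto simp: vec_eq_iff forall_3 intro!: continuous_intros)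
  obtain F where F: "isotopic_to_id F" "F ` curve_xy m g = curve_xy m h" "\<And>z. z$2 = 0 \<Longrightarrow> F z = z"
    using radial_lift[OF ij assms] unfolding curve_xy_def by auto
  from F(3) have "F ` curve_xz n k = curve_xz n k" for n k by (force simp: curve_xz_def)
  with F that show thesis by blast
qed

lemma change_gauge_xz:
  assumes "star_gauge g" "star_gauge h" "g (1, 0) = h (1, 0)" "g (-1, 0) = h (-1, 0)"
  obtains F where "isotopic_to_id F" "F ` curve_xz m g = curve_xz m h" "\<And>n k. F ` curve_xy n k = curve_xy n k"
proof -
  have ij: "homeomorphism UNIV UNIV (\<lambda>z::real^3. ((z$1 - m, z$3), z$2))
      (\<lambda>w. vector [fst (fst w) + m, snd w, snd (fst w)])"
    by (rule homeomorphismI) (auto simp: vec_eq_iff forall_3 intro!: continuous_intros)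
  obtain F where F: "isotopic_to_id F" "F ` curve_xz m g = curve_xz m h" "\<And>z. z$3 = 0 \<Longrightarrow> F z = z"
    using radial_lift[OF ij assms] unfolding curve_xz_def by auto
  from F(3) have "F ` curve_xy n k = curve_xy n k" for n k by (force simp: curve_xy_def)
  with F that show thesis by blast
qed

lemma simple_closed_curve_circle: "simple_closed_curve {p :: real \<times> real. norm p = 1}"
proof -
  define \<gamma> where "\<gamma> t = (cos (2 * pi * t), sin (2 * pi * t))" for t :: real
  have "path \<gamma>" unfolding path_def \<gamma>_def by (intro continuous_intros)
  moreover have "loop_free \<gamma>"
    unfolding loop_free_def
  proof (intro ballI impI)
    fix s t :: real assume st: "s \<in> {0..1}" "t \<in> {0..1}" "\<gamma> s = \<gamma> t"
    then obtain n :: int where n: "2 * pi * s = 2 * pi * t + 2 * pi * n"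
      using sin_cos_eq_iff[of "2 * pi * s" "2 * pi * t"] by (auto simp: \<gamma>_def)
    then have "2 * pi * s = 2 * pi * (t + n)" by (simp add: algebra_simps)
    then have "s = t + n" using pi_neq_zero by (simp only: mult_cancel_left) auto
    moreover have "\<bar>real_of_int n\<bar> \<le> 1" using calculation st by auto
    then have "n = -1 \<or> n = 0 \<or> n = 1" by linarith
    ultimately show "s = t \<or> s = 0 \<and> t = 1 \<or> s = 1 \<and> t = 0" using st by auto
  qed
  moreover have "pathfinish \<gamma> = pathstart \<gamma>" by (simp add: pathfinish_def pathstart_def \<gamma>_def)
  moreover have "path_image \<gamma> = {p. norm p = 1}"
  proof (intro equalityI subsetI)
    fix p :: "real \<times> real" assume "p \<in> {p. norm p = 1}"
    then have "(fst p)\<^sup>2 + (snd p)\<^sup>2 = 1" by (simp add: norm_prod_def)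
    then obtain u where u: "0 \<le> u" "u < 2 * pi" "fst p = cos u" "snd p = sin u"
      using sincos_total_2pi by metis
    have "p = \<gamma> (u / (2 * pi))" using u by (simp add: \<gamma>_def prod_eq_iff)
    then show "p \<in> path_image \<gamma>" using u by (auto simp: path_image_def)
  qed (auto simp: path_image_def \<gamma>_def norm_prod_def)
  ultimately show ?thesis unfolding simple_closed_curve_def simple_path_def by blast
qed

lemma standard_circles:
  "{vector [cos t, sin t, 0] | t. True} = curve_xy 0 norm"
  "{vector [1 + cos t, 0, sin t] | t. True} = curve_xz 1 norm"
proof -
  have *: "norm (c, s) = 1 \<longleftrightarrow> (\<exists>t. c = cos t \<and> s = sin t)" for c s :: real
    using sincos_total_2pi[of c s] by (auto simp: norm_prod_def)
  show "{vector [cos t, sin t, 0] | t. True} = curve_xy 0 norm"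
    unfolding curve_xy_def * by (auto simp: vec_eq_iff forall_3)
  show "{vector [1 + cos t, 0, sin t] | t. True} = curve_xz 1 norm"
    unfolding curve_xz_def * by (auto simp: vec_eq_iff forall_3) (metis add.commute diff_add_cancel)
qed

lemma standard_circles_hopf: "forms_hopf_link (curve_xy 0 norm) (curve_xz 1 norm)"
  unfolding forms_hopf_link_def
proof (intro conjI)
  have "curve_xy 0 norm = (\<lambda>p. vector [fst p, snd p, 0]) ` {p. norm p = 1}"
    by (force simp: curve_xy_def image_iff vec_eq_iff forall_3)
  also have "simple_closed_curve \<dots>"
    by (rule simple_closed_curve_image[OF simple_closed_curve_circle])
      (auto intro!: continuous_intros inj_onI simp: vec_eq_iff forall_3 prod_eq_iff)
  finally show "simple_closed_curve (curve_xy 0 norm)" .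
  have "curve_xz 1 norm = (\<lambda>p. vector [1 + fst p, 0, snd p]) ` {p. norm p = 1}"
  proof (intro equalityI subsetI)
    fix z assume "z \<in> curve_xz 1 norm"
    then show "z \<in> (\<lambda>p. vector [1 + fst p, 0, snd p]) ` {p. norm p = 1}"
      by (intro image_eqI[of _ _ "(z$1 - 1, z$3)"]) (auto simp: curve_xz_def vec_eq_iff forall_3)
  qed (auto simp: curve_xz_def)
  also have "simple_closed_curve \<dots>"
    by (rule simple_closed_curve_image[OF simple_closed_curve_circle])
      (auto intro!: continuous_intros inj_onI simp: vec_eq_iff forall_3 prod_eq_iff)
  finally show "simple_closed_curve (curve_xz 1 norm)" .
  have False if "\<bar>x\<bar> = 1" "\<bar>x - 1\<bar> = 1" for x :: real using that by linarith
  then show "curve_xy 0 norm \<inter> curve_xz 1 norm = {}"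
    by (auto simp: curve_xy_def curve_xz_def norm_prod_def simp del: real_sqrt_eq_1_iff)
  show "ambient_isotopic (curve_xy 0 norm \<union> curve_xz 1 norm) standard_hopf_link"
    unfolding ambient_isotopic_iff standard_hopf_link_def standard_circles
    by (rule exI[of _ "\<lambda>z. z"]) (simp add: isotopic_to_id_id)
qed

text \<open>
  The gauge of the rectangle \<open>[- l, r] \<times> [- 1, 1]\<close>. Rectangles serve as an intermediate shape because
  a map that acts on the first coordinate only sends rectangles to rectangles.
\<close>
definition box_gauge :: "real \<Rightarrow> real \<Rightarrow> real \<times> real \<Rightarrow> real" where
  "box_gauge l r p = max (max (fst p / r) (- fst p / l)) \<bar>snd p\<bar>"

lemma star_gauge_box:
  assumes "0 < l" "0 < r"
  shows "star_gauge (box_gauge l r)"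
  unfolding star_gauge_def
proof (intro conjI allI impI)
  show "continuous_on UNIV (box_gauge l r)" unfolding box_gauge_def by (intro continuous_intros) (use assms in auto)
  show "0 < box_gauge l r p" if "p \<noteq> 0" for p
  proof -
    have "0 < fst p / r \<or> 0 < - fst p / l \<or> 0 < \<bar>snd p\<bar>"
    proof (cases "snd p = 0")
      case True
      then have "0 < fst p \<or> 0 < - fst p" using that by (cases p) (simp add: zero_prod_def linorder_neq_iff disj_commute)
      then show ?thesis using assms by (metis divide_pos_pos)
    qed simp
    then show ?thesis by (auto simp only: box_gauge_def less_max_iff_disj)
  qed
  show "box_gauge l r (c *\<^sub>R p) = c * box_gauge l r p" if "0 \<le> c" for c p
    using that by (simp add: box_gauge_def max_mult_distrib_left abs_mult)
qed

lemma box_gauge_axis: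
  assumes "0 < l" "0 < r"
  shows "box_gauge l r (1, 0) = 1 / r" "box_gauge l r (-1, 0) = 1 / l"
proof -
  have "max (max u (- v)) 0 = u" if "0 < u" "0 < v" for u v :: real using that by (simp add: max_def)
  from this[of "1 / r" "1 / l"] this[of "1 / l" "1 / r"]
  show "box_gauge l r (1, 0) = 1 / r" "box_gauge l r (-1, 0) = 1 / l"
    using assms by (simp_all add: box_gauge_def max.commute)
qed

lemma box_gauge_eq_1:
  assumes "0 < l" "0 < r"
  shows "box_gauge l r (x, y) = 1 \<longleftrightarrow>
    - l \<le> x \<and> x \<le> r \<and> \<bar>y\<bar> \<le> 1 \<and> (x = - l \<or> x = r \<or> \<bar>y\<bar> = 1)"
proof -
  have "x / r \<le> 1 \<longleftrightarrow> x \<le> r" "- x / l \<le> 1 \<longleftrightarrow> - l \<le> x" "x / r = 1 \<longleftrightarrow> x = r" "- x / l = 1 \<longleftrightarrow> x = - l"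
    using assms by (auto simp: field_simps)
  moreover have "max (max u v) w = 1 \<longleftrightarrow> u \<le> 1 \<and> v \<le> 1 \<and> w \<le> 1 \<and> (u = 1 \<or> v = 1 \<or> w = 1)"
    for u v w :: real by (auto simp: max_def)
  ultimately show ?thesis unfolding box_gauge_def by simp blast
qed

lemma stretch_box_curves:
  assumes f: "isotopic_to_id f" "strict_mono f" "surj f"
  obtains F where "isotopic_to_id F"
    "\<And>m l r n l' r'. \<lbrakk>0 < l; 0 < r; 0 < l'; 0 < r'; f (m - l) = n - l'; f (m + r) = n + r'\<rbrakk> \<Longrightarrow>
       F ` curve_xy m (box_gauge l r) = curve_xy n (box_gauge l' r') \<and>
       F ` curve_xz m (box_gauge l r) = curve_xz n (box_gauge l' r')"
proof -
  let ?i = "\<lambda>z::real^3. (z$1, (z$2, z$3))" and ?j = "\<lambda>w. vector [fst w, fst (snd w), snd (snd w)] :: real^3"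
  let ?F = "\<lambda>z::real^3. vector [f (z$1), z$2, z$3] :: real^3"
  have "homeomorphism UNIV UNIV ?i ?j"
    by (rule homeomorphismI) (auto simp: vec_eq_iff forall_3 intro!: continuous_intros)
  from isotopic_to_id_conj[OF isotopic_to_id_prod[OF f(1)] this] have iso: "isotopic_to_id ?F"
    by (simp add: o_def)
  show thesis
  proof (rule that[of ?F, OF iso])
    fix m l r n l' r' :: real
    assume pos: "0 < l" "0 < r" "0 < l'" "0 < r'" and ends: "f (m - l) = n - l'" "f (m + r) = n + r'"
    have cmp: "- l \<le> x - m \<longleftrightarrow> - l' \<le> f x - n" "x - m \<le> r \<longleftrightarrow> f x - n \<le> r'"
      "x - m = - l \<longleftrightarrow> f x - n = - l'" "x - m = r \<longleftrightarrow> f x - n = r'" for x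
    proof -
      have "m - l \<le> x \<longleftrightarrow> n - l' \<le> f x" "x \<le> m + r \<longleftrightarrow> f x \<le> n + r'"
        "m - l = x \<longleftrightarrow> n - l' = f x" "x = m + r \<longleftrightarrow> f x = n + r'"
        using strict_mono_less_eq[OF f(2)] strict_mono_eq[OF f(2)] ends by metis+
      then show "- l \<le> x - m \<longleftrightarrow> - l' \<le> f x - n" "x - m \<le> r \<longleftrightarrow> f x - n \<le> r'"
        "x - m = - l \<longleftrightarrow> f x - n = - l'" "x - m = r \<longleftrightarrow> f x - n = r'"
        by linarith+
    qed
    have box: "box_gauge l r (x - m, y) = 1 \<longleftrightarrow> box_gauge l' r' (f x - n, y) = 1" for x y
      unfolding box_gauge_eq_1[OF pos(1,2)] box_gauge_eq_1[OF pos(3,4)] cmp ..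
    have surj: "\<exists>z. z$2 = w$2 \<and> z$3 = w$3 \<and> f (z$1) = w$1 \<and> w = ?F z" for w :: "real^3"
    proof -
      obtain x where "f x = w$1" using f(3) by (metis surjD)
      then show ?thesis by (intro exI[of _ "vector [x, w$2, w$3]"]) (simp add: vec_eq_iff forall_3)
    qed
    show "?F ` curve_xy m (box_gauge l r) = curve_xy n (box_gauge l' r') \<and>
       ?F ` curve_xz m (box_gauge l r) = curve_xz n (box_gauge l' r')"
    proof (intro conjI equalityI subsetI)
      fix w assume "w \<in> curve_xy n (box_gauge l' r')"
      then show "w \<in> ?F ` curve_xy m (box_gauge l r)"
        using surj[of w] by (auto simp: curve_xy_def box image_iff)
    next
      fix w assume "w \<in> curve_xz n (box_gauge l' r')"
      then show "w \<in> ?F ` curve_xz m (box_gauge l r)"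
        using surj[of w] by (auto simp: curve_xz_def box image_iff)
    qed (auto simp: curve_xy_def curve_xz_def box)
  qed
qed

text \<open>
  The hypotheses say that the two curves meet their common axis in interleaved pairs of points. Radial
  maps turn the curves into rectangles with the same points on the axis, a stretching of the axis
  moves these four points to \<open>- 1, 0, 1, 2\<close>, and radial maps turn the rectangles into the two circles of
  the standard link. None of the radial maps moves the curve in the other plane.
\<close>
lemma interleaved_hopf_link:
  assumes g: "star_gauge g" and h: "star_gauge h"
    and "m - 1 / g (-1, 0) < n - 1 / h (-1, 0)" "n - 1 / h (-1, 0) < m + 1 / g (1, 0)"
      "m + 1 / g (1, 0) < n + 1 / h (1, 0)"
  shows "forms_hopf_link (curve_xy m g) (curve_xz n h)"
proof -
  define l r l' r' where "l = 1 / g (-1, 0)" and "r = 1 / g (1, 0)" and "l' = 1 / h (-1, 0)" and "r' = 1 / h (1, 0)"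
  have pos: "0 < l" "0 < r" "0 < l'" "0 < r'"
    unfolding l_def r_def l'_def r'_def
    by (auto intro!: star_gaugeD(2)[OF g] star_gaugeD(2)[OF h] simp: zero_prod_def)
  note box = star_gauge_box[OF pos(1,2)] star_gauge_box[OF pos(3,4)] star_gauge_box[of 1 1, simplified]
  note axis = box_gauge_axis[OF pos(1,2)] box_gauge_axis[OF pos(3,4)] box_gauge_axis[of 1 1, simplified]
  obtain F1 where F1: "isotopic_to_id F1" "F1 ` curve_xy m g = curve_xy m (box_gauge l r)"
    "\<And>n k. F1 ` curve_xz n k = curve_xz n k"
    using change_gauge_xy[OF g box(1)] axis unfolding l_def r_def by auto
  obtain F2 where F2: "isotopic_to_id F2" "F2 ` curve_xz n h = curve_xz n (box_gauge l' r')"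
    "\<And>n k. F2 ` curve_xy n k = curve_xy n k"
    using change_gauge_xz[OF h box(2)] axis unfolding l'_def r'_def by auto
  have "m - l < n - l'" "n - l' < m + r" "m + r < n + r'"
    using assms by (simp_all add: l_def r_def l'_def r'_def)
  then obtain f where f: "isotopic_to_id f" "strict_mono f" "surj f" "f (m - l) = 0 - 1" "f (n - l') = 1 - 1"
    "f (m + r) = 0 + 1" "f (n + r') = 1 + 1"
    using stretch_four_points[of "m - l" "n - l'" "m + r" "n + r'" "0 - 1" "1 - 1" "0 + 1" "1 + 1"] by auto
  obtain F3 where F3: "isotopic_to_id F3"
    "F3 ` curve_xy m (box_gauge l r) = curve_xy 0 (box_gauge 1 1)"
    "F3 ` curve_xz n (box_gauge l' r') = curve_xz 1 (box_gauge 1 1)"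
    using stretch_box_curves[OF f(1-3)] f(4-) pos by (metis zero_less_one)
  obtain F4 where F4: "isotopic_to_id F4" "F4 ` curve_xy 0 (box_gauge 1 1) = curve_xy 0 norm"
    "\<And>n k. F4 ` curve_xz n k = curve_xz n k"
    using change_gauge_xy[OF box(3) star_gauge_norm] axis by (auto simp: norm_prod_def)
  obtain F5 where F5: "isotopic_to_id F5" "F5 ` curve_xz 1 (box_gauge 1 1) = curve_xz 1 norm"
    "\<And>n k. F5 ` curve_xy n k = curve_xy n k"
    using change_gauge_xz[OF box(3) star_gauge_norm] axis by (auto simp: norm_prod_def)
  have "forms_hopf_link (curve_xy 0 norm) (curve_xz 1 (box_gauge 1 1))"
    by (rule forms_hopf_link_image[OF F5(1)]) (simp only: F5 standard_circles_hopf)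
  then have "forms_hopf_link (curve_xy 0 (box_gauge 1 1)) (curve_xz 1 (box_gauge 1 1))"
    by (intro forms_hopf_link_image[OF F4(1), of "curve_xy 0 (box_gauge 1 1)"]) (simp only: F4)
  then have "forms_hopf_link (curve_xy m (box_gauge l r)) (curve_xz n (box_gauge l' r'))"
    by (intro forms_hopf_link_image[OF F3(1), of "curve_xy m (box_gauge l r)"]) (simp only: F3)
  then have "forms_hopf_link (curve_xy m (box_gauge l r)) (curve_xz n h)"
    by (intro forms_hopf_link_image[OF F2(1), of "curve_xy m (box_gauge l r)"]) (simp only: F2)
  then show ?thesis
    by (intro forms_hopf_link_image[OF F1(1), of "curve_xy m g"]) (simp only: F1)
qed

section \<open>Triangles around the origin of the plane\<close>

definition cross2 :: "real \<times> real \<Rightarrow> real \<times> real \<Rightarrow> real" where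
  "cross2 p q = fst p * snd q - snd p * fst q"

text \<open>
  The linear functional that equals 1 on the line through \<open>u\<close> and \<open>v\<close>.
\<close>
definition edge_functional :: "real \<times> real \<Rightarrow> real \<times> real \<Rightarrow> real \<times> real \<Rightarrow> real" where
  "edge_functional u v p = cross2 p (v - u) / cross2 u v"

definition triangle_gauge :: "real \<times> real \<Rightarrow> real \<times> real \<Rightarrow> real \<times> real \<Rightarrow> real \<times> real \<Rightarrow> real" where
  "triangle_gauge u v w p = max (edge_functional u v p) (max (edge_functional v w p) (edge_functional w u p))"

text \<open>
  The hypotheses say that the origin lies inside the triangle. Positivity: the three
  functionals have a combination with positive weights that vanishes identically, so their maximum is
  nonnegative, and it vanishes only where all three do, that is, at the origin.
\<close>
lemma star_gauge_triangle:
  assumes pos: "0 < cross2 u v" "0 < cross2 v w" "0 < cross2 w u"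
  shows "star_gauge (triangle_gauge u v w)"
  unfolding star_gauge_def
proof (intro conjI allI impI)
  show "continuous_on UNIV (triangle_gauge u v w)"
    unfolding triangle_gauge_def edge_functional_def cross2_def
    by (intro continuous_intros) (use pos in \<open>auto simp: cross2_def\<close>)
  show "triangle_gauge u v w (c *\<^sub>R p) = c * triangle_gauge u v w p" if "0 \<le> c" for c p
  proof -
    have "edge_functional s t (c *\<^sub>R p) = c * edge_functional s t p" for s t
      by (simp add: edge_functional_def cross2_def algebra_simps flip: times_divide_eq_right)
        (simp add: algebra_simps diff_divide_distrib)
    then show ?thesis using that by (simp add: triangle_gauge_def max_mult_distrib_left)
  qed
  show "0 < triangle_gauge u v w p" if "p \<noteq> 0" for p
  proof (rule ccontr)
    assume "\<not> 0 < triangle_gauge u v w p"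
    then have "edge_functional u v p \<le> 0" "edge_functional v w p \<le> 0" "edge_functional w u p \<le> 0"
      by (auto simp: triangle_gauge_def)
    then have le: "cross2 p (v - u) \<le> 0" "cross2 p (w - v) \<le> 0" "cross2 p (u - w) \<le> 0"
      using pos by (simp_all add: edge_functional_def divide_le_0_iff)
    moreover have "cross2 p (v - u) + cross2 p (w - v) + cross2 p (u - w) = 0"
      by (simp add: cross2_def algebra_simps)
    ultimately have z: "cross2 p (v - u) = 0" "cross2 p (w - v) = 0" by linarith+
    define d where "d = cross2 u v + cross2 v w + cross2 w u"
    have "d * fst p = (fst v - fst u) * cross2 p (w - v) - (fst w - fst v) * cross2 p (v - u)"
      "d * snd p = (snd v - snd u) * cross2 p (w - v) - (snd w - snd v) * cross2 p (v - u)"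
      by (simp_all add: d_def cross2_def algebra_simps)
    then have "fst p = 0" "snd p = 0" using z pos by (simp_all add: d_def)
    then show False using that by (simp add: prod_eq_iff)
  qed
qed

text \<open>
  On the line through \<open>u\<close> and \<open>v\<close>, the other two functionals bound the position from both sides: with
  \<open>p = (1 - t) u + t v\<close> they fall short of 1 by positive multiples of \<open>1 - t\<close> and of \<open>t\<close>.
\<close>
lemma mem_edge_iff:
  assumes pos: "0 < cross2 u v" "0 < cross2 v w" "0 < cross2 w u"
  shows "p \<in> closed_segment u v \<longleftrightarrow>
    edge_functional u v p = 1 \<and> edge_functional v w p \<le> 1 \<and> edge_functional w u p \<le> 1"
proof -
  define d where "d = cross2 u v + cross2 v w + cross2 w u"
  have d: "0 < d" using pos by (simp add: d_def)
  have ef: "edge_functional u v p = 1 \<longleftrightarrow> cross2 p (v - u) = cross2 u v"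
    "edge_functional v w p \<le> 1 \<longleftrightarrow> cross2 p (w - v) \<le> cross2 v w"
    "edge_functional w u p \<le> 1 \<longleftrightarrow> cross2 p (u - w) \<le> cross2 w u"
    using pos by (auto simp: edge_functional_def field_simps)
  have param: "cross2 p (v - u) = cross2 u v" "cross2 p (w - v) = cross2 v w - (1 - t) * d"
    "cross2 p (u - w) = cross2 w u - t * d" if "p = (1 - t) *\<^sub>R u + t *\<^sub>R v" for t
    by (simp_all add: that d_def cross2_def algebra_simps)
  show ?thesis
  proof
    assume "p \<in> closed_segment u v"
    then obtain t where t: "0 \<le> t" "t \<le> 1" "p = (1 - t) *\<^sub>R u + t *\<^sub>R v" by (auto simp: closed_segment_def)
    then show "edge_functional u v p = 1 \<and> edge_functional v w p \<le> 1 \<and> edge_functional w u p \<le> 1"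
      using param[OF t(3)] d unfolding ef by simp
  next
    assume e: "edge_functional u v p = 1 \<and> edge_functional v w p \<le> 1 \<and> edge_functional w u p \<le> 1"
    \<comment> \<open>Barycentric coordinate of \<open>p\<close> by Cramer's rule.\<close>
    define t where "t = cross2 u p / cross2 u v"
    have t: "cross2 u v * t = cross2 u p" using pos(1) by (simp add: t_def)
    have e1: "cross2 p (v - u) = cross2 u v" using e ef by blast
    have "cross2 u v * fst p = cross2 u v * fst ((1 - t) *\<^sub>R u + t *\<^sub>R v)"
    proof -
      have "cross2 u v * fst p = cross2 p v * fst u + cross2 u p * fst v"
        by (simp add: cross2_def algebra_simps)
      also have "cross2 p v = cross2 u v - cross2 u p" using e1 by (simp add: cross2_def algebra_simps)
      finally show ?thesis by (simp add: t[symmetric] algebra_simps)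
    qed
    moreover have "cross2 u v * snd p = cross2 u v * snd ((1 - t) *\<^sub>R u + t *\<^sub>R v)"
    proof -
      have "cross2 u v * snd p = cross2 p v * snd u + cross2 u p * snd v"
        by (simp add: cross2_def algebra_simps)
      also have "cross2 p v = cross2 u v - cross2 u p" using e1 by (simp add: cross2_def algebra_simps)
      finally show ?thesis by (simp add: t[symmetric] algebra_simps)
    qed
    ultimately have p: "p = (1 - t) *\<^sub>R u + t *\<^sub>R v" using pos(1) by (simp add: prod_eq_iff)
    have "0 \<le> (1 - t) * d" "0 \<le> t * d" using param[OF p] e ef by auto
    then have "0 \<le> t" "t \<le> 1" using d by (auto simp: zero_le_mult_iff)
    then show "p \<in> closed_segment u v" using p by (auto simp: closed_segment_def)
  qed
qed

lemma triangle_gauge_level_set: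
  assumes pos: "0 < cross2 u v" "0 < cross2 v w" "0 < cross2 w u"
  shows "{p. triangle_gauge u v w p = 1} = closed_segment u v \<union> closed_segment v w \<union> closed_segment w u"
proof -
  have "max x (max y z) = 1 \<longleftrightarrow>
      x = 1 \<and> y \<le> 1 \<and> z \<le> 1 \<or> y = 1 \<and> z \<le> 1 \<and> x \<le> 1 \<or> z = 1 \<and> x \<le> 1 \<and> y \<le> 1" for x y z :: real
    by (auto simp: max_def)
  then show ?thesis
    using mem_edge_iff[OF pos] mem_edge_iff[OF pos(2,3,1)] mem_edge_iff[OF pos(3,1,2)]
    unfolding triangle_gauge_def by blast
qed

section \<open>A triangle and its half-turn\<close>

definition rot3 :: "real^3^3" where
  "rot3 = vector [vector [0, 1, 0], vector [0, 0, -1], vector [-1, 0, 0]]"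

definition half_turn :: "real^3^3" where
  "half_turn = vector [vector [1, 0, 0], vector [0, -1, 0], vector [0, 0, -1]]"

definition orbit_triangle :: "real^3 \<Rightarrow> (real^3) set" where
  "orbit_triangle p = closed_segment p (rot3 *v p) \<union> closed_segment (rot3 *v p) (rot3 *v (rot3 *v p))
     \<union> closed_segment (rot3 *v (rot3 *v p)) p"

lemma matrix_vector_mult_3:
  fixes A :: "real^3^3"
  shows "A *v z = vector [A$1$1 * z$1 + A$1$2 * z$2 + A$1$3 * z$3,
    A$2$1 * z$1 + A$2$2 * z$2 + A$2$3 * z$3, A$3$1 * z$1 + A$3$2 * z$2 + A$3$3 * z$3]"
  by (simp add: vec_eq_iff forall_3 matrix_vector_mult_def sum_3)

lemma rot3_apply: "rot3 *v z = vector [z$2, - z$3, - z$1]"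
  by (simp add: matrix_vector_mult_3 rot3_def)

lemma half_turn_apply: "half_turn *v z = vector [z$1, - z$2, - z$3]"
  by (simp add: matrix_vector_mult_3 half_turn_def)

text \<open>
  The determinant of the segment from the identity to \<open>A\<close> has this form when the characteristic
  polynomial of \<open>A\<close> is \<open>X\<^sup>3 - k\<close>, which for \<open>0 < k\<close> has no negative real root.
\<close>
lemma isotopic_to_id_matrix_3:
  fixes A :: "real^3^3"
  assumes "\<And>t. 0 \<le> t \<Longrightarrow> t \<le> 1 \<Longrightarrow> det ((1 - t) *\<^sub>R mat 1 + t *\<^sub>R A) = (1 - t)^3 + k * t^3"
    and "0 < k"
  shows "isotopic_to_id ((*v) A)"
proof (rule isotopic_to_id_matrix)
  fix t :: real assume t: "0 \<le> t" "t \<le> 1"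
  have "0 < (1 - t)^3 + k * t^3"
  proof (cases "t = 1")
    case False
    then show ?thesis using t assms(2) by (intro add_pos_nonneg) auto
  qed (use assms(2) in simp)
  then show "det ((1 - t) *\<^sub>R mat 1 + t *\<^sub>R A) \<noteq> 0" using assms(1)[OF t] by simp
qed

lemma isotopic_to_id_rot3: "isotopic_to_id ((*v) rot3)"
  by (rule isotopic_to_id_matrix_3[where k = 1])
    (simp_all add: det_3 rot3_def mat_def power3_eq_cube)

text \<open>
  The straight segment from the identity to a half-turn becomes singular; two quarter-turns avoid this.
\<close>
lemma isotopic_to_id_half_turn: "isotopic_to_id ((*v) half_turn)"
proof -
  define Q :: "real^3^3" where "Q = vector [vector [1, 0, 0], vector [0, 0, -1], vector [0, 1, 0]]"
  have "isotopic_to_id ((*v) Q)"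
  proof (rule isotopic_to_id_matrix)
    fix t :: real
    have "det ((1 - t) *\<^sub>R mat 1 + t *\<^sub>R Q) = (1 - t)\<^sup>2 + t\<^sup>2"
      by (simp add: det_3 Q_def mat_def power2_eq_square algebra_simps)
    moreover have "(1 - t)\<^sup>2 + t\<^sup>2 \<noteq> 0" by (simp add: sum_power2_eq_zero_iff)
    ultimately show "det ((1 - t) *\<^sub>R mat 1 + t *\<^sub>R Q) \<noteq> 0" by simp
  qed
  then have "isotopic_to_id ((*v) Q \<circ> (*v) Q)" using isotopic_to_id_comp by blast
  moreover have "(*v) Q \<circ> (*v) Q = (*v) half_turn"
    by (rule ext) (simp add: Q_def matrix_vector_mult_3 half_turn_def)
  ultimately show ?thesis by simp
qed

text \<open>
  The triangle lies in the plane \<open>X + Y - Z = K\<close> with \<open>K = a + b - c\<close>, and its half-turn lies in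
  \<open>X - Y + Z = K\<close>. The two planes meet in the line \<open>X = K, Y = Z\<close>, which the half-turn reverses around
  \<open>(K, 0, 0)\<close>. The first three hypotheses put \<open>(K, 0, 0)\<close> inside the first triangle, so that this triangle meets
  the line in points \<open>- l\<close> and \<open>r\<close> on both sides of the centre, and its half-turn in \<open>- r\<close> and \<open>l\<close>.
  These pairs are interleaved unless \<open>l = r\<close>; in the orientation chosen below, \<open>0 < b + c\<close> and
  \<open>cmp\<close> give \<open>r < l\<close>. An affine map takes the planes to coordinate planes and the line to the first axis.
\<close>
lemma orbit_triangle_half_turn_hopf:
  fixes a b c :: real
  assumes pos: "0 < c^2 - a*b" "0 < a^2 + b*c" "0 < b^2 + a*c" "0 < b + c"
    and cmp: "(b - a) * (a^2 + b*c) < (b + c) * (c^2 - a*b)" "(a + c) * (a^2 + b*c) < (b + c) * (b^2 + a*c)"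
  shows "forms_hopf_link (orbit_triangle (vector [a, b, c])) ((*v) half_turn ` orbit_triangle (vector [a, b, c]))"
proof -
  let ?p = "vector [a, b, c] :: real^3"
  \<comment> \<open>The vertices in the coordinates that \<open>F\<close> below induces on the plane of the triangle.\<close>
  define u v w where "u = (- (b + c), 2 * (b - c))" and "v = (a + c, 2 * (a - c))" and "w = (b - a, 2 * (a + b))"
  have cr: "cross2 u v = 4 * (c^2 - a*b)" "cross2 v w = 4 * (a^2 + b*c)" "cross2 w u = 4 * (b^2 + a*c)"
    by (simp_all add: u_def v_def w_def cross2_def algebra_simps power2_eq_square)
  then have cp: "0 < cross2 u v" "0 < cross2 v w" "0 < cross2 w u" using pos by simp_all
  let ?g = "triangle_gauge u v w"
  have g: "star_gauge ?g" by (rule star_gauge_triangle[OF cp])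
  have h: "star_gauge (\<lambda>p. ?g (- p))"
    unfolding star_gauge_def
  proof (intro conjI allI impI)
    show "continuous_on UNIV (\<lambda>p. ?g (- p))"
      by (intro continuous_on_compose2[OF star_gaugeD(1)[OF g, of UNIV]] continuous_intros) auto
  qed (use star_gaugeD(2,3)[OF g] in \<open>auto simp flip: scaleR_minus_right\<close>)

  \<comment> \<open>The rows are the direction of the common line and the normals of the two planes.
    Their signs and scale make the characteristic polynomial \<open>X\<^sup>3 - 4\<close>.\<close>
  define M :: "real^3^3" where "M = vector [vector [0, -1, -1], vector [-1, 1, -1], vector [1, 1, -1]]"
  define o' :: "real^3" where "o' = vector [- (a + b - c), 0, 0]"
  define F where "F = (*v) M \<circ> (\<lambda>z. o' + z)"
  have "isotopic_to_id ((*v) M)"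
    by (rule isotopic_to_id_matrix_3[where k = 4])
      (simp_all add: det_3 M_def mat_def power3_eq_cube algebra_simps)
  then have F: "isotopic_to_id F" unfolding F_def by (rule isotopic_to_id_comp[OF _ isotopic_to_id_translation])
  have F_apply: "F z = vector [- (z$2 + z$3), - (z$1 - (a + b - c)) + z$2 - z$3, (z$1 - (a + b - c)) + z$2 - z$3]" for z
    by (simp add: F_def M_def o'_def matrix_vector_mult_3 vec_eq_iff forall_3)
  have F_seg: "F ` closed_segment s t = closed_segment (F s) (F t)" for s t
    unfolding F_def image_comp[symmetric] closed_segment_translation[symmetric]
    by (simp add: closed_segment_linear_image matrix_vector_mul_linear)

  define e :: "real \<times> real \<Rightarrow> real^3" where "e p = vector [fst p, snd p, 0]" for p
  have "linear e" by (rule linearI) (simp_all add: e_def vec_eq_iff forall_3)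
  then have e_seg: "e ` closed_segment s t = closed_segment (e s) (e t)" for s t
    by (simp add: closed_segment_linear_image)
  have "F ?p = e u" "F (rot3 *v ?p) = e v" "F (rot3 *v (rot3 *v ?p)) = e w"
    by (simp_all add: F_apply e_def rot3_apply u_def v_def w_def vec_eq_iff forall_3)
  then have "F ` orbit_triangle ?p = e ` {p. ?g p = 1}"
    unfolding orbit_triangle_def triangle_gauge_level_set[OF cp] image_Un F_seg e_seg by simp
  also have "\<dots> = curve_xy 0 ?g"
    by (force simp: curve_xy_def e_def image_iff vec_eq_iff forall_3)
  finally have A: "F ` orbit_triangle ?p = curve_xy 0 ?g" .
  \<comment> \<open>In the new coordinates, the half-turn exchanges the two planes and reverses the axis.\<close>
  have "F (half_turn *v z) = vector [- F z $ 1, - F z $ 3, - F z $ 2]" for z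
    by (simp add: F_apply half_turn_apply vec_eq_iff forall_3)
  then have "F ` (*v) half_turn ` orbit_triangle ?p = (\<lambda>z. vector [- z$1, - z$3, - z$2]) ` F ` orbit_triangle ?p"
    unfolding image_image by simp
  also have "\<dots> = curve_xz 0 (\<lambda>p. ?g (- p))"
    unfolding A
  proof (intro equalityI subsetI)
    fix z assume "z \<in> curve_xz 0 (\<lambda>p. ?g (- p))"
    then show "z \<in> (\<lambda>z. vector [- z$1, - z$3, - z$2]) ` curve_xy 0 ?g"
      by (intro image_eqI[of _ _ "vector [- z$1, - z$3, - z$2]"])
        (auto simp: curve_xz_def curve_xy_def vec_eq_iff forall_3)
  qed (auto simp: curve_xz_def curve_xy_def)
  finally have B: "F ` (*v) half_turn ` orbit_triangle ?p = curve_xz 0 (\<lambda>p. ?g (- p))" .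

  \<comment> \<open>\<open>1 / q\<close> is the distance from the origin at which the line through \<open>v\<close> and \<open>w\<close> meets the positive axis.\<close>
  define q where "q = (b + c) / (2 * (a^2 + b*c))"
  have q: "0 < q" using pos by (simp add: q_def)
  have "edge_functional u v (-1, 0) = (b - a) / (2 * (c^2 - a*b))"
    "edge_functional v w (-1, 0) = - q" "edge_functional w u (-1, 0) = (a + c) / (2 * (b^2 + a*c))"
    "edge_functional v w (1, 0) = q"
    unfolding edge_functional_def cr using pos
    by (simp_all add: u_def v_def w_def cross2_def q_def field_simps)
  moreover have "s / (2 * k) < t / (2 * m)" if "s * m < t * k" "0 < k" "0 < m" for s t k m :: real
    using that by (simp add: field_simps)
  then have "(b - a) / (2 * (c^2 - a*b)) < q" "(a + c) / (2 * (b^2 + a*c)) < q"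
    unfolding q_def using cmp pos by blast+
  ultimately have "?g (-1, 0) < q" "q \<le> ?g (1, 0)"
    using q by (simp_all add: triangle_gauge_def)
  then have less: "?g (-1, 0) < ?g (1, 0)" by simp
  have gp: "0 < ?g (-1, 0)" "0 < ?g (1, 0)" by (auto intro!: star_gaugeD(2)[OF g] simp: zero_prod_def)
  have "1 / ?g (1, 0) < 1 / ?g (-1, 0)" using less gp by (simp add: frac_less2)
  moreover have "0 < 1 / ?g (1, 0)" using gp by simp
  ultimately have "forms_hopf_link (curve_xy 0 ?g) (curve_xz 0 (\<lambda>p. ?g (- p)))"
    by (intro interleaved_hopf_link g h) simp_all
  then show ?thesis
    using forms_hopf_link_image[OF F, of "orbit_triangle ?p" "(*v) half_turn ` orbit_triangle ?p"]
    unfolding A B by blast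
qed

section \<open>The stress vector on the curve\<close>

text \<open>
  Since \<open>p0 x y\<close> is in the kernel of the stress matrix, its coordinates satisfy two linear relations
  on the curve, \<open>r1\<close> and \<open>r2\<close>. With \<open>B\<close> the mean of \<open>b\<close> and \<open>c\<close>, \<open>r2\<close> says that \<open>b = B - \<kappa> a\<close> and
  \<open>c = B + \<kappa> a\<close>, where \<open>0 < \<kappa> \<le> 1/8\<close>; and \<open>r1\<close> together with the equation \<open>r3\<close> of the curve
  bounds \<open>a\<close> by \<open>(1 + \<kappa>) \<bar>a\<bar> < B\<close>. From there on the claims concern products of linear and
  quadratic forms in \<open>a\<close> and \<open>B\<close>. Replacing \<open>a\<close> by \<open>- a\<close> exchanges \<open>b\<close> with \<open>c\<close>, so that
  \<open>c\<^sup>2 - a b\<close> and \<open>b\<^sup>2 + a c\<close>, and likewise the last two claims, are treated alike.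
\<close>
lemma p0_inequalities:
  fixes x y :: real
  assumes curve: "x^2 * y + 3*x^2 - x*y - 3*y^2 - 3*x - 3*y = 0"
    and x: "0 < x" "x < 1" and y: "-1/3 \<le> y" "y < 0"
  defines "a \<equiv> p0 x y $ 1" and "b \<equiv> p0 x y $ 2" and "c \<equiv> p0 x y $ 3"
  shows "0 < c^2 - a*b" "0 < a^2 + b*c" "0 < b^2 + a*c" "0 < b + c"
    "(b - a) * (a^2 + b*c) < (b + c) * (c^2 - a*b)" "(a + c) * (a^2 + b*c) < (b + c) * (b^2 + a*c)"
proof -
  define u where "u = 1 - 2 * x"
  define B where "B = (b + c) / 2"
  define \<kappa> where "\<kappa> = - y / (3 + y)"
  have abc: "a = - 2*x*y + 3*y^2 - 6*x + 2*y + 3" "b = - 4*x^2 - 4*x*y + 3*y^2 + 4*x + 10*y + 3"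
    "c = 4*x^2 - 3*y^2 - 4*x + 3" by (simp_all add: a_def b_def c_def p0_def)
  have B_eq: "B = 3 + 5*y - 2*x*y" by (simp add: B_def abc)
  have "x * y < 0" using x y by (simp add: mult_pos_neg)
  then have B: "0 < B" using y unfolding B_eq by (simp add: mult.assoc)
  have \<kappa>: "0 < \<kappa>" "\<kappa> \<le> 1/8" using y by (auto simp: \<kappa>_def field_simps)
  have \<kappa>': "1 + \<kappa> = 3 / (3 + y)" using y by (simp add: \<kappa>_def field_simps)
  \<comment> \<open>The first row of the stress matrix, with \<open>b - c\<close> eliminated by \<open>r2\<close>.\<close>
  have r1: "(3 + 4*y) * a = (3 + y) * u * B"
    using curve unfolding abc B_eq u_def by algebra
  \<comment> \<open>The difference of the other two rows.\<close>
  have r2: "(3 + y) * (b - c) = 2 * y * a" using curve unfolding abc by algebra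
  \<comment> \<open>The equation of the curve, with the square in \<open>x\<close> completed.\<close>
  have r3: "u^2 * (3 + y) = (1 + 3*y) * (3 + 4*y)" using curve unfolding u_def by algebra
  have u: "3 * \<bar>u\<bar> < 3 + 4*y"
  proof -
    have "9 * (1 + 3*y) < (3 + 4*y) * (3 + y)" 
    proof -
      have "0 < y * (y - 3)" using y by (simp add: mult_neg_neg)
      then show ?thesis by (simp add: algebra_simps)
    qed
    then have "(3 + 4*y) * (9 * (1 + 3*y)) < (3 + 4*y) * ((3 + 4*y) * (3 + y))"
      using y by (intro mult_strict_left_mono) auto
    moreover have "(3 * \<bar>u\<bar>)^2 * (3 + y) = (3 + 4*y) * (9 * (1 + 3*y))"
    proof -
      have "(3 * \<bar>u\<bar>)^2 * (3 + y) = 9 * (u^2 * (3 + y))" by (simp add: power_mult_distrib)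
      also have "\<dots> = (3 + 4*y) * (9 * (1 + 3*y))" unfolding r3 by (simp add: algebra_simps)
      finally show ?thesis .
    qed
    ultimately have "(3 * \<bar>u\<bar>)^2 * (3 + y) < (3 + 4*y)^2 * (3 + y)" by (simp add: power2_eq_square mult.assoc)
    then have "(3 * \<bar>u\<bar>)^2 < (3 + 4*y)^2" using y by simp
    moreover have "0 \<le> 3 + 4*y" using y by simp
    ultimately show ?thesis by (rule power_less_imp_less_base)
  qed
  have bc: "b = B - \<kappa> * a" "c = B + \<kappa> * a"
  proof -
    have "b - c = - 2 * (\<kappa> * a)" using r2 y by (simp add: \<kappa>_def field_simps)
    then show "b = B - \<kappa> * a" "c = B + \<kappa> * a" by (simp_all add: B_def field_simps)
  qed
  have a: "(1 + \<kappa>) * \<bar>a\<bar> < B"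
  proof -
    have "(3 + 4*y) * \<bar>a\<bar> = (3 + y) * \<bar>u\<bar> * B"
      using arg_cong[OF r1, of abs] y B by (simp add: abs_mult)
    then have "(3 + 4*y) * (3 * \<bar>a\<bar>) = (3 + y) * B * (3 * \<bar>u\<bar>)" by simp
    also have "\<dots> < (3 + y) * B * (3 + 4*y)" using u y B by (intro mult_strict_left_mono) auto
    finally have "3 * \<bar>a\<bar> < (3 + y) * B" using y by (simp add: mult.commute)
    then show ?thesis unfolding \<kappa>' using y by (simp add: field_simps)
  qed
  have "\<bar>a\<bar> \<le> (1 + \<kappa>) * \<bar>a\<bar>" using \<kappa> by (simp add: mult_le_cancel_right1)
  then have aB: "\<bar>a\<bar> < B" using a by simp
  have main: "0 < B^2 - (1 - 2*\<kappa>) * t * B + \<kappa> * (1 + \<kappa>) * t^2" if t: "\<bar>t\<bar> < B" for t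
  proof -
    have "(1 - 2*\<kappa>) * t \<le> \<bar>t\<bar>"
    proof -
      have "\<bar>(1 - 2*\<kappa>) * t\<bar> \<le> 1 * \<bar>t\<bar>" unfolding abs_mult using \<kappa> by (intro mult_right_mono) auto
      then show ?thesis by simp
    qed
    then have "(1 - 2*\<kappa>) * t * B < B * B" using t B by (intro mult_strict_right_mono) auto
    moreover have "0 \<le> \<kappa> * (1 + \<kappa>) * t^2" using \<kappa> by simp
    ultimately show ?thesis by (simp add: power2_eq_square)
  qed
  \<comment> \<open>A quadratic form of negative discriminant.\<close>
  have quad: "0 < B^2 + 2 * (1 - 2*\<kappa>) * t * B + (1 - \<kappa>^2) * t^2" for t
  proof -
    have "B^2 + 2 * (1 - 2*\<kappa>) * t * B + (1 - \<kappa>^2) * t^2 = (B + (1 - 2*\<kappa>) * t)^2 + \<kappa> * (4 - 5*\<kappa>) * t^2"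
      by (simp add: power2_eq_square algebra_simps)
    moreover have "0 < (B + (1 - 2*\<kappa>) * t)^2 + \<kappa> * (4 - 5*\<kappa>) * t^2"
    proof (cases "t = 0")
      case False
      then show ?thesis using \<kappa> by (intro add_nonneg_pos) auto
    qed (use B in simp)
    ultimately show ?thesis by simp
  qed
  have "c^2 - a*b = B^2 - (1 - 2*\<kappa>) * a * B + \<kappa> * (1 + \<kappa>) * a^2"
    unfolding bc by (simp add: power2_eq_square algebra_simps)
  with main[OF aB] show "0 < c^2 - a*b" by simp
  have "b^2 + a*c = B^2 - (1 - 2*\<kappa>) * (- a) * B + \<kappa> * (1 + \<kappa>) * (- a)^2"
    unfolding bc by (simp add: power2_eq_square algebra_simps)
  with main[of "- a"] aB show "0 < b^2 + a*c" by simp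
  have "\<kappa>^2 \<le> 1" using \<kappa> by (simp add: power_le_one)
  have "a^2 + b*c = B^2 + (1 - \<kappa>^2) * a^2" unfolding bc by (simp add: power2_eq_square algebra_simps)
  moreover have "0 < B^2 + (1 - \<kappa>^2) * a^2" using B \<open>\<kappa>^2 \<le> 1\<close> by (intro add_pos_nonneg) auto
  ultimately show "0 < a^2 + b*c" by simp
  show "0 < b + c" using B by (simp add: B_def)
  have "\<bar>(1 + \<kappa>) * a\<bar> < B" using a \<kappa> by (simp add: abs_mult)
  then have lin: "0 < B - (1 + \<kappa>) * a" "0 < B + (1 + \<kappa>) * a" by linarith+
  have "(b + c) * (c^2 - a*b) - (b - a) * (a^2 + b*c)
      = (B + (1 + \<kappa>) * a) * (B^2 + 2 * (1 - 2*\<kappa>) * (- a) * B + (1 - \<kappa>^2) * (- a)^2)"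
    unfolding bc by (simp add: power2_eq_square algebra_simps)
  moreover have "0 < \<dots>" by (intro mult_pos_pos lin quad)
  ultimately show "(b - a) * (a^2 + b*c) < (b + c) * (c^2 - a*b)" by simp
  have "(b + c) * (b^2 + a*c) - (a + c) * (a^2 + b*c)
      = (B - (1 + \<kappa>) * a) * (B^2 + 2 * (1 - 2*\<kappa>) * a * B + (1 - \<kappa>^2) * a^2)"
    unfolding bc by (simp add: power2_eq_square algebra_simps)
  moreover have "0 < \<dots>" by (intro mult_pos_pos lin quad)
  ultimately show "(a + c) * (a^2 + b*c) < (b + c) * (b^2 + a*c)" by simp
qed

section \<open>The alternating group and its cosets\<close>

text \<open>
  The subgroup generated by \<open>g1\<close>, as an explicit set. It is also the stabilizer of 4 in the alternating group.
\<close>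
definition g1_powers :: "(nat \<Rightarrow> nat) set" where
  "g1_powers = {id, g1, g1 \<circ> g1}"

lemma g1_eq: "g1 = Transposition.transpose 1 2 \<circ> Transposition.transpose 2 3"
  and g2_eq: "g2 = Transposition.transpose 1 2 \<circ> Transposition.transpose 3 4"
  by (simp_all add: g1_def g2_def)

lemma g1_in_A4: "g1 \<in> carrier A4"
  unfolding alt_group_carrier g1_eq
  by (auto intro!: permutes_compose permutes_swap_id simp: evenperm_comp permutation_swap_id evenperm_swap)

lemma g2_in_A4: "g2 \<in> carrier A4"
  unfolding alt_group_carrier g2_eq
  by (auto intro!: permutes_compose permutes_swap_id simp: evenperm_comp permutation_swap_id evenperm_swap)

lemma A4_comp: "g \<in> carrier A4 \<Longrightarrow> h \<in> carrier A4 \<Longrightarrow> g \<circ> h \<in> carrier A4"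
  using monoid.m_closed[OF group.is_monoid[OF alt_group_is_group]] by (metis alt_group_mult)

lemma A4_inverse:
  assumes "g \<in> carrier A4"
  obtains h where "h \<in> carrier A4" "h \<circ> g = id" "g \<circ> h = id"
  using group.l_inv[OF alt_group_is_group assms] group.r_inv[OF alt_group_is_group assms]
    group.inv_closed[OF alt_group_is_group assms]
  by (metis alt_group_mult alt_group_one)

lemma g1_powers_in_A4: "s \<in> g1_powers \<Longrightarrow> s \<in> carrier A4"
  using group.is_monoid[OF alt_group_is_group, THEN monoid.one_closed, of 4]
  by (auto simp: g1_powers_def g1_in_A4 A4_comp alt_group_one)

lemma g1_cubed: "g1 \<circ> (g1 \<circ> g1) = id"
proof
  fix z :: nat
  consider "z \<in> {1, 2, 3}" | "z \<notin> {1, 2, 3}" by blast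
  then show "(g1 \<circ> (g1 \<circ> g1)) z = id z"
    by cases (auto simp: g_values numeral_2_eq_2[symmetric], auto simp: g1_eq Transposition.transpose_def)
qed

lemma g1_powers_comp: "s \<in> g1_powers \<Longrightarrow> t \<in> g1_powers \<Longrightarrow> s \<circ> t \<in> g1_powers"
  using g1_cubed by (auto simp: g1_powers_def comp_assoc)

lemma g1_powers_inverse:
  assumes "s \<in> g1_powers"
  obtains t where "t \<in> g1_powers" "t \<circ> s = id" "s \<circ> t = id"
proof -
  consider "s = id" | "s = g1" | "s = g1 \<circ> g1" using assms by (auto simp: g1_powers_def)
  then show thesis
  proof cases
    case 1
    then show ?thesis by (intro that[of id]) (simp_all add: g1_powers_def)
  next
    case 2
    then show ?thesis by (intro that[of "g1 \<circ> g1"]) (simp_all add: g1_powers_def comp_assoc g1_cubed)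
  next
    case 3
    then show ?thesis by (intro that[of g1]) (simp_all add: g1_powers_def comp_assoc g1_cubed)
  qed
qed

lemma g1_powers_transitive:
  assumes "i \<in> {1, 2, 3}" "j \<in> {1, 2, 3}"
  obtains s where "s \<in> g1_powers" "s i = j" "s 4 = 4"
proof -
  note g = g_values(1-4) g1_powers_def
  consider "i = j" | "i = 1 \<and> j = 2 \<or> i = 2 \<and> j = 3 \<or> i = 3 \<and> j = 1"
    | "i = 1 \<and> j = 3 \<or> i = 2 \<and> j = 1 \<or> i = 3 \<and> j = 2"
    using assms by blast
  then show thesis
  proof cases
    case 1
    then show ?thesis by (intro that[of id]) (simp_all add: g1_powers_def)
  next
    case 2
    then show ?thesis by (intro that[of g1]) (auto simp: g simp del: One_nat_def)
  next
    case 3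
    then show ?thesis by (intro that[of "g1 \<circ> g1"]) (auto simp: g simp del: One_nat_def)
  qed
qed

text \<open>
  The only other permutation of four points that fixes 1 and 4 is a transposition, which is odd.
\<close>
lemma A4_fixes_1_4:
  assumes k: "k \<in> carrier A4" and "k 1 = 1" "k 4 = 4"
  shows "k = id"
proof -
  have p: "k permutes {1..4}" and ev: "evenperm k" using k alt_group_carrier by auto
  have out: "k z = z" if "z \<notin> {1..4}" for z using permutes_not_in[OF p that] .
  have inj: "inj k" using permutes_inj[OF p] .
  have "k 2 \<in> {1, 2, 3, 4}" "k 3 \<in> {1, 2, 3, 4}"
    unfolding atLeastAtMost_1_4[symmetric] by (simp_all only: permutes_in_image[OF p]) simp_all
  moreover have "k 2 \<noteq> 1" "k 2 \<noteq> 4" "k 3 \<noteq> 1" "k 3 \<noteq> 4" "k 2 \<noteq> k 3"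
    using injD[OF inj, of 2 1] injD[OF inj, of 2 4] injD[OF inj, of 3 1] injD[OF inj, of 3 4]
      injD[OF inj, of 2 3] assms(2,3) by auto
  ultimately have "k 2 = 2 \<and> k 3 = 3 \<or> k 2 = 3 \<and> k 3 = 2" unfolding insert_iff empty_iff by metis
  then show ?thesis
  proof
    assume "k 2 = 2 \<and> k 3 = 3"
    then have "k z = id z" for z
      using out[of z] assms(2,3) atLeastAtMost_1_4 by (cases "z \<in> {1..4}") auto
    then show ?thesis by blast
  next
    assume "k 2 = 3 \<and> k 3 = 2"
    then have "k z = Transposition.transpose 2 3 z" for z
      using out[of z] assms(2,3) atLeastAtMost_1_4
      by (cases "z \<in> {1..4}") (auto simp: Transposition.transpose_def)
    then have "k = Transposition.transpose 2 3" by blast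
    with ev show ?thesis by (simp add: evenperm_swap)
  qed
qed

lemma A4_stabilizer_4:
  assumes k: "k \<in> carrier A4" and k4: "k 4 = 4"
  shows "k \<in> g1_powers"
proof -
  have p: "k permutes {1..4}" using k alt_group_carrier by auto
  have "k 1 \<in> {1..4}" by (simp only: permutes_in_image[OF p]) simp
  moreover have "k 1 \<noteq> k 4" using permutes_inj[OF p] by (simp add: inj_eq)
  ultimately have "k 1 \<in> {1, 2, 3}" using k4 by auto
  then obtain s where s: "s \<in> g1_powers" "s (k 1) = 1" "s 4 = 4" using g1_powers_transitive[of "k 1" 1] by auto
  then have "s \<circ> k = id" using A4_fixes_1_4[of "s \<circ> k"] A4_comp[OF g1_powers_in_A4 k] k4 by simp
  moreover obtain t where t: "t \<in> g1_powers" "t \<circ> s = id" using g1_powers_inverse[OF s(1)] by blast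
  ultimately show ?thesis by (metis comp_assoc comp_id id_comp)
qed

text \<open>
  As \<open>g1_powers\<close> is the stabilizer of 4 and acts transitively on the other three points, its double
  cosets correspond to its two orbits \<open>{4}\<close> and \<open>{1, 2, 3}\<close>; the element \<open>g2\<close> moves 4 to 3.
\<close>
lemma A4_double_coset:
  assumes k: "k \<in> carrier A4" and "k \<notin> g1_powers"
  obtains s t where "s \<in> g1_powers" "t \<in> g1_powers" "k = s \<circ> g2 \<circ> t"
proof -
  have p: "k permutes {1..4}" using k alt_group_carrier by auto
  have "k 4 \<in> {1..4}" by (simp only: permutes_in_image[OF p]) simp
  moreover have "k 4 \<noteq> 4" using A4_stabilizer_4[OF k] assms(2) by blast
  ultimately have "k 4 \<in> {1, 2, 3}" by auto
  then obtain s where s: "s \<in> g1_powers" "s 3 = k 4" using g1_powers_transitive[of 3 "k 4"] by auto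
  obtain s' where s': "s' \<in> g1_powers" "s' \<circ> s = id" "s \<circ> s' = id" using g1_powers_inverse[OF s(1)] by blast
  obtain h where h: "h \<in> carrier A4" "h \<circ> g2 = id" "g2 \<circ> h = id" using A4_inverse[OF g2_in_A4] .
  have "(h \<circ> s' \<circ> k) 4 = 4"
    using s s'(2) h(2) g_values(8) by (metis comp_apply id_apply)
  moreover have "h \<circ> s' \<circ> k \<in> carrier A4"
    by (intro A4_comp h(1) k g1_powers_in_A4[OF s'(1)])
  ultimately have t: "h \<circ> s' \<circ> k \<in> g1_powers" by (intro A4_stabilizer_4)
  have "k = s \<circ> g2 \<circ> (h \<circ> s' \<circ> k)" using s'(3) h(3) by (metis comp_assoc id_comp)
  with s(1) t that show thesis by blast
qed

lemma generate_g1: "generate A4 {g1} = g1_powers"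
proof (intro equalityI subsetI)
  fix k assume "k \<in> generate A4 {g1}"
  then show "k \<in> g1_powers"
  proof induction
    case one
    then show ?case unfolding alt_group_one g1_powers_def by blast
  next
    case (incl h)
    then show ?case by (simp add: g1_powers_def)
  next
    case (inv h)
    have "inv\<^bsub>A4\<^esub> g1 = g1 \<circ> g1"
      by (rule group.inv_equality[OF alt_group_is_group])
        (simp_all add: alt_group_mult alt_group_one g1_cubed comp_assoc g1_in_A4 A4_comp)
    then have "inv\<^bsub>A4\<^esub> h = g1 \<circ> g1" using inv by simp
    then show ?case unfolding g1_powers_def by blast
  next
    case (eng h1 h2)
    show ?case unfolding alt_group_mult by (rule g1_powers_comp[OF eng.IH])
  qed
next
  fix k assume "k \<in> g1_powers"
  then show "k \<in> generate A4 {g1}"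
    using generate.one[of A4 "{g1}"] generate.incl[of g1 "{g1}" A4] generate.eng[of g1 A4 "{g1}" g1]
    by (auto simp: g1_powers_def alt_group_mult alt_group_one)
qed

lemma card_lcosets_g1: "card (lcosets\<^bsub>A4\<^esub> g1_powers) = 4"
proof -
  have "2 * card (carrier A4) = fact 4" by (rule alt_group_card_carrier) simp
  then have card: "card (carrier A4) = 12" by (simp add: fact_numeral)
  have sub: "subgroup g1_powers A4"
    using group.generate_is_subgroup[OF alt_group_is_group, of "{g1}" 4] g1_in_A4 by (simp add: generate_g1)
  have "g1 1 \<noteq> id 1" "(g1 \<circ> g1) 1 \<noteq> id 1" "(g1 \<circ> g1) 1 \<noteq> g1 1" by (simp_all add: g_values del: One_nat_def)
  then have "id \<noteq> g1" "id \<noteq> g1 \<circ> g1" "g1 \<noteq> g1 \<circ> g1" by metis+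
  then have "card g1_powers = 3" by (simp add: g1_powers_def)
  moreover have "finite (carrier A4)" using card card.infinite by fastforce
  ultimately show ?thesis
    using group.l_lagrange[OF alt_group_is_group _ sub] card by (simp add: order_def)
qed

lemma lcoset_g1: "g <#\<^bsub>A4\<^esub> g1_powers = {g, g \<circ> g1, g \<circ> (g1 \<circ> g1)}"
  by (auto simp: l_coset_def g1_powers_def alt_group_mult)

section \<open>The strut triangles\<close>

definition real_rep :: "((nat \<Rightarrow> nat) \<Rightarrow> int^3^3) \<Rightarrow> (nat \<Rightarrow> nat) \<Rightarrow> real^3^3" where
  "real_rep \<rho> g = map_matrix real_of_int (\<rho> g)"

context
  fixes \<rho> :: "(nat \<Rightarrow> nat) \<Rightarrow> int^3^3"
  assumes rep: "A4_representation \<rho>"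
begin

lemma real_rep_comp:
  assumes "g \<in> carrier A4" "h \<in> carrier A4"
  shows "real_rep \<rho> (g \<circ> h) = real_rep \<rho> g ** real_rep \<rho> h"
proof -
  have "\<rho> (g \<circ> h) = \<rho> g ** \<rho> h"
    using rep assms hom_mult[of \<rho> A4 GL3Z g h] by (simp add: A4_representation_def alt_group_mult GL3Z_def)
  then show ?thesis
    by (simp add: real_rep_def map_matrix_def matrix_matrix_mult_def vec_eq_iff)
qed

lemma real_rep_g1: "real_rep \<rho> g1 = rot3" and real_rep_g2: "real_rep \<rho> g2 = half_turn"
  using rep by (simp_all add: A4_representation_def real_rep_def rot3_def half_turn_def map_matrix_def vec_eq_iff forall_3)

lemma real_rep_id: "real_rep \<rho> id = mat 1"
proof -
  have "real_rep \<rho> (g1 \<circ> (g1 \<circ> g1)) = rot3 ** (rot3 ** rot3)"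
    by (simp add: real_rep_comp g1_in_A4 A4_comp real_rep_g1)
  also have "\<dots> = mat 1" by (simp add: matrix_matrix_mult_def rot3_def sum_3 vec_eq_iff forall_3 mat_def)
  finally show ?thesis by (simp add: g1_cubed)
qed

lemma isotopic_to_id_real_rep:
  assumes k: "k \<in> carrier A4"
  shows "isotopic_to_id ((*v) (real_rep \<rho> k))"
proof -
  have comp: "isotopic_to_id ((*v) (real_rep \<rho> (g \<circ> h)))"
    if "g \<in> carrier A4" "h \<in> carrier A4" "isotopic_to_id ((*v) (real_rep \<rho> g))" "isotopic_to_id ((*v) (real_rep \<rho> h))" for g h
  proof -
    have "(*v) (real_rep \<rho> (g \<circ> h)) = (*v) (real_rep \<rho> g) \<circ> (*v) (real_rep \<rho> h)"
      by (rule ext) (simp add: real_rep_comp[OF that(1,2)] matrix_vector_mul_assoc)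
    then show ?thesis using isotopic_to_id_comp[OF that(3,4)] by simp
  qed
  have g1: "isotopic_to_id ((*v) (real_rep \<rho> g1))" and g2: "isotopic_to_id ((*v) (real_rep \<rho> g2))"
    by (simp_all only: real_rep_g1 real_rep_g2 isotopic_to_id_rot3 isotopic_to_id_half_turn)
  have "(*v) (real_rep \<rho> id) = (\<lambda>z. z)" by (rule ext) (simp add: real_rep_id)
  then have "isotopic_to_id ((*v) (real_rep \<rho> id))" by (simp only: isotopic_to_id_id)
  then have pow: "isotopic_to_id ((*v) (real_rep \<rho> s))" if "s \<in> g1_powers" for s
    using that comp[OF g1_in_A4 g1_in_A4 g1 g1] g1 by (auto simp: g1_powers_def)
  show ?thesis
  proof (cases "k \<in> g1_powers")
    case False
    then obtain s t where "s \<in> g1_powers" "t \<in> g1_powers" "k = s \<circ> g2 \<circ> t" using A4_double_coset[OF k] by blast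
    then show ?thesis
      by (simp add: comp A4_comp g1_powers_in_A4 g2_in_A4 pow g2)
  qed (rule pow)
qed

text \<open>
  The representation is linear and multiplicative, so each strut triangle is an image of one fixed triangle.
\<close>
lemma strut_triangle_lcoset:
  assumes g: "g \<in> carrier A4"
  shows "strut_triangle \<rho> x y (g <#\<^bsub>A4\<^esub> g1_powers) = (*v) (real_rep \<rho> g) ` orbit_triangle (p0 x y)"
proof -
  let ?p = "p0 x y"
  have n: "node \<rho> x y h = real_rep \<rho> h *v ?p" for h by (simp add: node_def real_rep_def)
  have 0: "node \<rho> x y g = real_rep \<rho> g *v ?p" by (rule n)
  have 1: "node \<rho> x y (g \<circ> g1) = real_rep \<rho> g *v (rot3 *v ?p)"
    by (simp add: n real_rep_comp g g1_in_A4 real_rep_g1 matrix_vector_mul_assoc)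
  have 2: "node \<rho> x y (g \<circ> (g1 \<circ> g1)) = real_rep \<rho> g *v (rot3 *v (rot3 *v ?p))"
    by (simp add: n real_rep_comp g g1_in_A4 A4_comp real_rep_g1 matrix_vector_mul_assoc matrix_mul_assoc)
  have "g \<circ> (g1 \<circ> g1) \<circ> g1 = g" using g1_cubed by (simp add: comp_assoc)
  then have 3: "node \<rho> x y (g \<circ> (g1 \<circ> g1) \<circ> g1) = real_rep \<rho> g *v ?p" by (simp only: n)
  show ?thesis
    unfolding strut_triangle_def lcoset_g1 strut_def alt_group_mult orbit_triangle_def image_Un
      closed_segment_linear_image[OF matrix_vector_mul_linear, symmetric]
    using 0 1 2 3 by (simp add: Un_assoc comp_assoc)
qed

lemma orbit_triangle_invariant:
  assumes "s \<in> g1_powers"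
  shows "(*v) (real_rep \<rho> s) ` orbit_triangle p = orbit_triangle p"
proof -
  have rot: "rot3 *v (rot3 *v (rot3 *v z)) = z" for z by (simp add: rot3_apply vec_eq_iff forall_3)
  have 1: "(*v) rot3 ` orbit_triangle p = orbit_triangle p"
    unfolding orbit_triangle_def image_Un closed_segment_linear_image[OF matrix_vector_mul_linear, symmetric] rot
    by blast
  have "(*v) (rot3 ** rot3) ` orbit_triangle p = (*v) rot3 ` (*v) rot3 ` orbit_triangle p"
    by (simp add: image_image matrix_vector_mul_assoc)
  then show ?thesis
    using assms 1 by (auto simp: g1_powers_def real_rep_id real_rep_g1 real_rep_comp[OF g1_in_A4 g1_in_A4])
qed

lemma image_real_rep_comp:
  assumes "g \<in> carrier A4" "h \<in> carrier A4"
  shows "(*v) (real_rep \<rho> (g \<circ> h)) ` X = (*v) (real_rep \<rho> g) ` (*v) (real_rep \<rho> h) ` X"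
  by (simp add: real_rep_comp[OF assms] image_image matrix_vector_mul_assoc)

text \<open>
  Put \<open>k = g\<^sup>-\<^sup>1 h\<close>, written as \<open>s g2 t\<close> with \<open>s, t\<close> in \<open>g1_powers\<close>. Both \<open>s\<close> and \<open>t\<close> preserve the
  base triangle, so the pair is the image under \<open>g s\<close> of the base triangle and its half-turn. The
  inverse of \<open>g s\<close> is isotopic to the identity.
\<close>
lemma rotated_triangles_hopf:
  assumes base: "forms_hopf_link (orbit_triangle p) ((*v) half_turn ` orbit_triangle p)"
    and g: "g \<in> carrier A4" and h: "h \<in> carrier A4"
    and ne: "g <#\<^bsub>A4\<^esub> g1_powers \<noteq> h <#\<^bsub>A4\<^esub> g1_powers"
  shows "forms_hopf_link ((*v) (real_rep \<rho> g) ` orbit_triangle p) ((*v) (real_rep \<rho> h) ` orbit_triangle p)"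
proof -
  obtain g' where g': "g' \<in> carrier A4" "g' \<circ> g = id" "g \<circ> g' = id" using A4_inverse[OF g] .
  define k where "k = g' \<circ> h"
  have k: "k \<in> carrier A4" unfolding k_def by (rule A4_comp[OF g'(1) h])
  have hk: "h = g \<circ> k" unfolding k_def using g'(3) by (metis comp_assoc id_comp)
  have "k \<notin> g1_powers"
  proof
    assume "k \<in> g1_powers"
    then have "h <#\<^bsub>A4\<^esub> g1_powers = g <#\<^bsub>A4\<^esub> g1_powers"
      using g1_cubed unfolding lcoset_g1 hk by (auto simp: g1_powers_def comp_assoc)
    with ne show False by simp
  qed
  then obtain s t where st: "s \<in> g1_powers" "t \<in> g1_powers" "k = s \<circ> g2 \<circ> t" using A4_double_coset[OF k] by blast
  note A4 = g1_powers_in_A4[OF st(1)] g1_powers_in_A4[OF st(2)] g2_in_A4 g A4_comp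
  have second: "(*v) (real_rep \<rho> h) ` orbit_triangle p = (*v) (real_rep \<rho> (g \<circ> s)) ` (*v) half_turn ` orbit_triangle p"
    unfolding hk st(3) by (simp add: image_real_rep_comp A4 orbit_triangle_invariant st real_rep_g2)
  have first: "(*v) (real_rep \<rho> g) ` orbit_triangle p = (*v) (real_rep \<rho> (g \<circ> s)) ` orbit_triangle p"
    by (simp add: image_real_rep_comp A4 orbit_triangle_invariant st)
  obtain q where q: "q \<in> carrier A4" "q \<circ> (g \<circ> s) = id" using A4_inverse[OF A4_comp[OF g A4(1)]] by blast
  have undo: "(*v) (real_rep \<rho> q) ` (*v) (real_rep \<rho> (g \<circ> s)) ` X = X" for X
    using image_real_rep_comp[OF q(1), of "g \<circ> s" X] A4 by (simp add: q(2) real_rep_id)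
  show ?thesis
    unfolding first second
    by (rule forms_hopf_link_image[OF isotopic_to_id_real_rep[OF q(1)]]) (simp only: undo base)
qed

end

text \<open>
  Distinct cosets give linked, hence disjoint and distinct triangles; so there are as many triangles as cosets.
\<close>
theorem theorem1:
  fixes \<rho> :: "(nat \<Rightarrow> nat) \<Rightarrow> int^3^3" and x y :: real
  assumes "A4_representation \<rho>"
    and "x^2 * y + 3*x^2 - x*y - 3*y^2 - 3*x - 3*y = 0"
    and "0 < x" and "x < 1" and "-1/3 \<le> y" and "y < 0"
  shows "mutual_hopf_link 4 (strut_triangles \<rho> x y)"
proof -
  let ?L = "lcosets\<^bsub>A4\<^esub> g1_powers" and ?T = "strut_triangle \<rho> x y"
  have "p0 x y = vector [p0 x y $ 1, p0 x y $ 2, p0 x y $ 3]" by (simp add: vec_eq_iff forall_3)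
  then have base: "forms_hopf_link (orbit_triangle (p0 x y)) ((*v) half_turn ` orbit_triangle (p0 x y))"
    using orbit_triangle_half_turn_hopf p0_inequalities[OF assms(2-)] by metis
  have link: "forms_hopf_link (?T C) (?T C')" if C: "C \<in> ?L" "C' \<in> ?L" "C \<noteq> C'" for C C'
  proof -
    obtain g h where gh: "g \<in> carrier A4" "h \<in> carrier A4" "C = g <#\<^bsub>A4\<^esub> g1_powers" "C' = h <#\<^bsub>A4\<^esub> g1_powers"
      using C(1,2) by (auto simp: LCOSETS_def)
    show ?thesis
      using rotated_triangles_hopf[OF assms(1) base gh(1,2)] C(3)
      unfolding gh(3,4) strut_triangle_lcoset[OF assms(1) gh(1)] strut_triangle_lcoset[OF assms(1) gh(2)] by blast
  qed
  have "inj_on ?T ?L"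
  proof (rule inj_onI, rule ccontr)
    fix C C' assume C: "C \<in> ?L" "C' \<in> ?L" "?T C = ?T C'" "C \<noteq> C'"
    then have "?T C = {}" using link[OF C(1,2,4)] by (simp add: forms_hopf_link_def)
    moreover obtain g where "g \<in> carrier A4" "C = g <#\<^bsub>A4\<^esub> g1_powers" using C(1) by (auto simp: LCOSETS_def)
    ultimately show False using strut_triangle_lcoset[OF assms(1)] by (simp add: orbit_triangle_def)
  qed
  then have "card (?T ` ?L) = 4" by (simp add: card_image card_lcosets_g1)
  moreover have "pairwise forms_hopf_link (?T ` ?L)"
    by (rule pairwise_imageI) (use link in blast)
  ultimately show ?thesis
    unfolding mutual_hopf_link_def strut_triangles_def generate_g1 by blast
qed

end
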